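(* Let $G$ be a finite group. If a $2+1$D TQFT $\mathcal{T}$ (with modular tensor category $C$) is obtained from gauging a 0-form symmetry $G$ of another TQFT, then so is every Galois conjugate of $\mathcal{T}$: for every $q\in\mathrm{Gal}(K_{C})$, the theory with modular tensor category $q(C)$ is also obtained from gauging a symmetry $G$ of some TQFT.
   Context: A modular tensor category (MTC) $C$ is described, after choosing bases of the fusion spaces $V_{ab}^c$ (such a choice is called a gauge), by its $F$ symbols (associativity matrices), $R$ symbols (braiding matrices) and pivotal coefficients $\epsilon_a\in\{\pm1\}$. There is always a gauge in which all entries of $F$ and $R$ lie in a number field; fix such a gauge; $K_C$ is the normal closure over $\mathbb{Q}$ of $\mathbb{Q}(F,R)$. For $q\in\mathrm{Gal}(K_C):=\mathrm{Gal}(K_C/\mathbb{Q})$, the Galois conjugate $q(C)$ is the MTC with the same simple objects, fusion rules and $\epsilon_a$, and with data $q(F),q(R)$. A $2+1$D TQFT is an MTC together with a choice of sign of $\mathcal{D}=\pm\sqrt{\sum_a d_a^2}$; Galois actions do not change this sign choice. Gauging: given an MTC $C_0$ with an action of a finite group $G$ (a 0-form symmetry), and provided certain obstructions vanish, one constructs a $G$-crossed braided extension $(C_0)_G=\oplus_{g\in G}C_g$ with faithful grading and $C_e=C_0$; the gauged theory is the MTC $C_0^G$ given by the equivariantization (category of $G$-equivariant objects) of $(C_0)_G$. It contains $\mathrm{Rep}(G)$ as a fusion subcategory, and condensing this $\mathrm{Rep}(G)$ gives back $C_0$. *)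

theory Defs
  imports
    Complex_Main
    "HOL-Algebra.Generated_Fields"
    "HOL-Algebra.Embedded_Algebras"
    "HOL-Algebra.QuotRing"
    "HOL-Computational_Algebra.Polynomial"
begin

section \<open>Complex-linear categories\<close>

text \<open>
  The hom-spaces of a category are subspaces of one vector space of arrows. They may overlap
  (in \<^verbatim>\<open>0\<close>, and in the equivariantization below, where a hom-space depends on an equivariant
  structure that the arrow does not record), so an arrow does not determine its source and target
  and every statement about arrows names a hom-space. No generality is lost: the hom-spaces of an
  arbitrary linear category embed in their direct sum.
\<close>

record ('o, 'm) linear_cat =
  Ob :: "'o set"
  Hom :: "'o \<Rightarrow> 'o \<Rightarrow> 'm set"
  idt :: "'o \<Rightarrow> 'm"
  cmp :: "'m \<Rightarrow> 'm \<Rightarrow> 'm"  (infixr \<open>\<bullet>\<index>\<close> 70)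
  scal :: "complex \<Rightarrow> 'm \<Rightarrow> 'm"

locale linear_category =
  fixes C :: "('o, 'm::ab_group_add, 'x) linear_cat_scheme" (structure)
  assumes arrows_vector_space: "Vector_Spaces.vector_space (scal C)"
    and Hom_subspace:
      "\<lbrakk>x \<in> Ob C; y \<in> Ob C\<rbrakk> \<Longrightarrow> Modules.module.subspace (scal C) (Hom C x y)"
    and idt_in_Hom: "x \<in> Ob C \<Longrightarrow> idt C x \<in> Hom C x x"
    and cmp_in_Hom:
      "\<lbrakk>x \<in> Ob C; y \<in> Ob C; z \<in> Ob C; f \<in> Hom C x y; g \<in> Hom C y z\<rbrakk>
        \<Longrightarrow> g \<bullet> f \<in> Hom C x z"
    and cmp_idt_left: "\<lbrakk>x \<in> Ob C; y \<in> Ob C; f \<in> Hom C x y\<rbrakk> \<Longrightarrow> idt C y \<bullet> f = f"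
    and cmp_idt_right: "\<lbrakk>x \<in> Ob C; y \<in> Ob C; f \<in> Hom C x y\<rbrakk> \<Longrightarrow> f \<bullet> idt C x = f"
    and cmp_assoc:
      "\<lbrakk>w \<in> Ob C; x \<in> Ob C; y \<in> Ob C; z \<in> Ob C;
        f \<in> Hom C w x; g \<in> Hom C x y; h \<in> Hom C y z\<rbrakk> \<Longrightarrow> (h \<bullet> g) \<bullet> f = h \<bullet> (g \<bullet> f)"
    and cmp_add_right:
      "\<lbrakk>x \<in> Ob C; y \<in> Ob C; z \<in> Ob C; f \<in> Hom C x y; f' \<in> Hom C x y; g \<in> Hom C y z\<rbrakk>
        \<Longrightarrow> g \<bullet> (f + f') = g \<bullet> f + g \<bullet> f'"
    and cmp_add_left:
      "\<lbrakk>x \<in> Ob C; y \<in> Ob C; z \<in> Ob C; f \<in> Hom C x y; g \<in> Hom C y z; g' \<in> Hom C y z\<rbrakk>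
        \<Longrightarrow> (g + g') \<bullet> f = g \<bullet> f + g' \<bullet> f"
    and cmp_scal_right:
      "\<lbrakk>x \<in> Ob C; y \<in> Ob C; z \<in> Ob C; f \<in> Hom C x y; g \<in> Hom C y z\<rbrakk>
        \<Longrightarrow> g \<bullet> scal C t f = scal C t (g \<bullet> f)"
    and cmp_scal_left:
      "\<lbrakk>x \<in> Ob C; y \<in> Ob C; z \<in> Ob C; f \<in> Hom C x y; g \<in> Hom C y z\<rbrakk>
        \<Longrightarrow> scal C t g \<bullet> f = scal C t (g \<bullet> f)"

definition iso_in :: "('o, 'm, 'x) linear_cat_scheme \<Rightarrow> 'o \<Rightarrow> 'o \<Rightarrow> 'm \<Rightarrow> bool" where
  "iso_in C x y f \<longleftrightarrow>
    f \<in> Hom C x y \<and>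
    (\<exists>g \<in> Hom C y x. g \<bullet>\<^bsub>C\<^esub> f = idt C x \<and> f \<bullet>\<^bsub>C\<^esub> g = idt C y)"

definition inv_in :: "('o, 'm, 'x) linear_cat_scheme \<Rightarrow> 'o \<Rightarrow> 'o \<Rightarrow> 'm \<Rightarrow> 'm" where
  "inv_in C x y f =
    (THE g. g \<in> Hom C y x \<and> g \<bullet>\<^bsub>C\<^esub> f = idt C x \<and> f \<bullet>\<^bsub>C\<^esub> g = idt C y)"

definition isomorphic_in :: "('o, 'm, 'x) linear_cat_scheme \<Rightarrow> 'o \<Rightarrow> 'o \<Rightarrow> bool" where
  "isomorphic_in C x y \<longleftrightarrow> (\<exists>f. iso_in C x y f)"

text \<open>\<^verbatim>\<open>s\<close> is the direct sum of the finite family \<^verbatim>\<open>X\<close>; a zero object if \<^verbatim>\<open>J\<close> is empty.\<close>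

definition direct_sum ::
  "('o, 'm::ab_group_add, 'x) linear_cat_scheme \<Rightarrow> 'j set \<Rightarrow> ('j \<Rightarrow> 'o) \<Rightarrow> 'o
    \<Rightarrow> ('j \<Rightarrow> 'm) \<Rightarrow> ('j \<Rightarrow> 'm) \<Rightarrow> bool" where
  "direct_sum C J X s \<iota> \<pi> \<longleftrightarrow>
    finite J \<and> s \<in> Ob C \<and>
    (\<forall>j\<in>J. X j \<in> Ob C \<and> \<iota> j \<in> Hom C (X j) s \<and> \<pi> j \<in> Hom C s (X j)) \<and>
    (\<forall>j\<in>J. \<forall>k\<in>J. \<pi> k \<bullet>\<^bsub>C\<^esub> \<iota> j = (if j = k then idt C (X j) else 0)) \<and>
    (\<Sum>j\<in>J. \<iota> j \<bullet>\<^bsub>C\<^esub> \<pi> j) = idt C s"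

definition simple_object :: "('o, 'm::ab_group_add, 'x) linear_cat_scheme \<Rightarrow> 'o \<Rightarrow> bool" where
  "simple_object C x \<longleftrightarrow>
    x \<in> Ob C \<and> idt C x \<noteq> 0 \<and> Hom C x x = range (\<lambda>t. scal C t (idt C x))"

text \<open>
  Semisimplicity in the form of Turaev and Virelizier: \<^verbatim>\<open>I\<close> is a set of pairwise non-isomorphic
  simple objects of which every object is a finite direct sum.
\<close>

definition simple_representatives ::
  "('o, 'm::ab_group_add, 'x) linear_cat_scheme \<Rightarrow> 'o set \<Rightarrow> bool" where
  "simple_representatives C I \<longleftrightarrow>
    (\<forall>x\<in>I. simple_object C x) \<and>
    (\<forall>x\<in>I. \<forall>y\<in>I. x \<noteq> y \<longrightarrow> Hom C x y = {0}) \<and>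
    (\<forall>s\<in>Ob C. \<exists>(n::nat) X \<iota> \<pi>. (\<forall>j<n. X j \<in> I) \<and> direct_sum C {..<n} X s \<iota> \<pi>)"


section \<open>Monoidal and spherical fusion categories\<close>

text \<open>Objects are tensored by \<^verbatim>\<open>\<boxtimes>\<close> and arrows by \<^verbatim>\<open>\<star>\<close>.\<close>

record ('o, 'm) monoidal_cat = "('o, 'm) linear_cat" +
  tob :: "'o \<Rightarrow> 'o \<Rightarrow> 'o"  (infixr \<open>\<boxtimes>\<index>\<close> 75)
  tar :: "'m \<Rightarrow> 'm \<Rightarrow> 'm"  (infixr \<open>\<star>\<index>\<close> 75)
  unit_ob :: "'o"  (\<open>\<I>\<index>\<close>)
  asc :: "'o \<Rightarrow> 'o \<Rightarrow> 'o \<Rightarrow> 'm"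
  lun :: "'o \<Rightarrow> 'm"
  run :: "'o \<Rightarrow> 'm"

definition asc_inv :: "('o, 'm, 'x) monoidal_cat_scheme \<Rightarrow> 'o \<Rightarrow> 'o \<Rightarrow> 'o \<Rightarrow> 'm" where
  "asc_inv C x y z =
    inv_in C ((x \<boxtimes>\<^bsub>C\<^esub> y) \<boxtimes>\<^bsub>C\<^esub> z) (x \<boxtimes>\<^bsub>C\<^esub> (y \<boxtimes>\<^bsub>C\<^esub> z)) (asc C x y z)"

locale monoidal_linear_category = linear_category C
  for C :: "('o, 'm::ab_group_add, 'x) monoidal_cat_scheme" (structure) +
  assumes unit_in_Ob: "\<I> \<in> Ob C"
    and tob_in_Ob: "\<lbrakk>x \<in> Ob C; y \<in> Ob C\<rbrakk> \<Longrightarrow> x \<boxtimes> y \<in> Ob C"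
    and tar_in_Hom:
      "\<lbrakk>x \<in> Ob C; y \<in> Ob C; x' \<in> Ob C; y' \<in> Ob C; f \<in> Hom C x x'; h \<in> Hom C y y'\<rbrakk>
        \<Longrightarrow> f \<star> h \<in> Hom C (x \<boxtimes> y) (x' \<boxtimes> y')"
    and tar_idt: "\<lbrakk>x \<in> Ob C; y \<in> Ob C\<rbrakk> \<Longrightarrow> idt C x \<star> idt C y = idt C (x \<boxtimes> y)"
    and tar_cmp:
      "\<lbrakk>x \<in> Ob C; y \<in> Ob C; x' \<in> Ob C; y' \<in> Ob C; x'' \<in> Ob C; y'' \<in> Ob C;
        f \<in> Hom C x x'; f' \<in> Hom C x' x''; h \<in> Hom C y y'; h' \<in> Hom C y' y''\<rbrakk>
        \<Longrightarrow> (f' \<bullet> f) \<star> (h' \<bullet> h) = (f' \<star> h') \<bullet> (f \<star> h)"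
    and tar_add_left:
      "\<lbrakk>x \<in> Ob C; y \<in> Ob C; x' \<in> Ob C; y' \<in> Ob C;
        f \<in> Hom C x x'; f' \<in> Hom C x x'; h \<in> Hom C y y'\<rbrakk> \<Longrightarrow> (f + f') \<star> h = f \<star> h + f' \<star> h"
    and tar_add_right:
      "\<lbrakk>x \<in> Ob C; y \<in> Ob C; x' \<in> Ob C; y' \<in> Ob C;
        f \<in> Hom C x x'; h \<in> Hom C y y'; h' \<in> Hom C y y'\<rbrakk> \<Longrightarrow> f \<star> (h + h') = f \<star> h + f \<star> h'"
    and tar_scal_left:
      "\<lbrakk>x \<in> Ob C; y \<in> Ob C; x' \<in> Ob C; y' \<in> Ob C; f \<in> Hom C x x'; h \<in> Hom C y y'\<rbrakk>
        \<Longrightarrow> scal C t f \<star> h = scal C t (f \<star> h)"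
    and tar_scal_right:
      "\<lbrakk>x \<in> Ob C; y \<in> Ob C; x' \<in> Ob C; y' \<in> Ob C; f \<in> Hom C x x'; h \<in> Hom C y y'\<rbrakk>
        \<Longrightarrow> f \<star> scal C t h = scal C t (f \<star> h)"
    and asc_iso:
      "\<lbrakk>x \<in> Ob C; y \<in> Ob C; z \<in> Ob C\<rbrakk>
        \<Longrightarrow> iso_in C ((x \<boxtimes> y) \<boxtimes> z) (x \<boxtimes> (y \<boxtimes> z)) (asc C x y z)"
    and asc_natural:
      "\<lbrakk>x \<in> Ob C; y \<in> Ob C; z \<in> Ob C; x' \<in> Ob C; y' \<in> Ob C; z' \<in> Ob C;
        f \<in> Hom C x x'; h \<in> Hom C y y'; k \<in> Hom C z z'\<rbrakk>
        \<Longrightarrow> asc C x' y' z' \<bullet> ((f \<star> h) \<star> k) = (f \<star> (h \<star> k)) \<bullet> asc C x y z"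
    and lun_iso: "x \<in> Ob C \<Longrightarrow> iso_in C (\<I> \<boxtimes> x) x (lun C x)"
    and lun_natural:
      "\<lbrakk>x \<in> Ob C; y \<in> Ob C; f \<in> Hom C x y\<rbrakk>
        \<Longrightarrow> lun C y \<bullet> (idt C \<I> \<star> f) = f \<bullet> lun C x"
    and run_iso: "x \<in> Ob C \<Longrightarrow> iso_in C (x \<boxtimes> \<I>) x (run C x)"
    and run_natural:
      "\<lbrakk>x \<in> Ob C; y \<in> Ob C; f \<in> Hom C x y\<rbrakk>
        \<Longrightarrow> run C y \<bullet> (f \<star> idt C \<I>) = f \<bullet> run C x"
    and pentagon:
      "\<lbrakk>w \<in> Ob C; x \<in> Ob C; y \<in> Ob C; z \<in> Ob C\<rbrakk>
        \<Longrightarrow> (idt C w \<star> asc C x y z) \<bullet> asc C w (x \<boxtimes> y) z \<bullet> (asc C w x y \<star> idt C z)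
            = asc C w x (y \<boxtimes> z) \<bullet> asc C (w \<boxtimes> x) y z"
    and triangle:
      "\<lbrakk>x \<in> Ob C; y \<in> Ob C\<rbrakk>
        \<Longrightarrow> (idt C x \<star> lun C y) \<bullet> asc C x \<I> y = run C x \<star> idt C y"

text \<open>
  A pivotal structure is given as a pivotal duality: every object has a dual that is both a left
  dual (\<^verbatim>\<open>lev\<close>, \<^verbatim>\<open>lcoev\<close>) and a right dual (\<^verbatim>\<open>rev\<close>, \<^verbatim>\<open>rcoev\<close>), and the two resulting
  contravariant functors coincide as monoidal functors. A pivotal isomorphism from \<^verbatim>\<open>x\<close> to its
  double dual is the same thing as the right duality morphisms, given the left ones.
\<close>

record ('o, 'm) pivotal_cat = "('o, 'm) monoidal_cat" +
  dual :: "'o \<Rightarrow> 'o"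
  lev :: "'o \<Rightarrow> 'm"
  lcoev :: "'o \<Rightarrow> 'm"
  rev :: "'o \<Rightarrow> 'm"
  rcoev :: "'o \<Rightarrow> 'm"

text \<open>
  The nested evaluations
  \<^verbatim>\<open>(y* \<boxtimes> x*) \<boxtimes> (x \<boxtimes> y) \<rightarrow> \<I>\<close> and \<^verbatim>\<open>(x \<boxtimes> y) \<boxtimes> (y* \<boxtimes> x*) \<rightarrow> \<I>\<close>.
\<close>

definition nested_lev :: "('o, 'm, 'x) pivotal_cat_scheme \<Rightarrow> 'o \<Rightarrow> 'o \<Rightarrow> 'm" where
  "nested_lev C x y =
    lev C y \<bullet>\<^bsub>C\<^esub> (idt C (dual C y) \<star>\<^bsub>C\<^esub> lun C y)
    \<bullet>\<^bsub>C\<^esub> (idt C (dual C y) \<star>\<^bsub>C\<^esub> (lev C x \<star>\<^bsub>C\<^esub> idt C y))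
    \<bullet>\<^bsub>C\<^esub> (idt C (dual C y) \<star>\<^bsub>C\<^esub> asc_inv C (dual C x) x y)
    \<bullet>\<^bsub>C\<^esub> asc C (dual C y) (dual C x) (x \<boxtimes>\<^bsub>C\<^esub> y)"

definition nested_rev :: "('o, 'm, 'x) pivotal_cat_scheme \<Rightarrow> 'o \<Rightarrow> 'o \<Rightarrow> 'm" where
  "nested_rev C x y =
    rev C x \<bullet>\<^bsub>C\<^esub> (idt C x \<star>\<^bsub>C\<^esub> lun C (dual C x))
    \<bullet>\<^bsub>C\<^esub> (idt C x \<star>\<^bsub>C\<^esub> (rev C y \<star>\<^bsub>C\<^esub> idt C (dual C x)))
    \<bullet>\<^bsub>C\<^esub> (idt C x \<star>\<^bsub>C\<^esub> asc_inv C y (dual C y) (dual C x))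
    \<bullet>\<^bsub>C\<^esub> asc C x y (dual C y \<boxtimes>\<^bsub>C\<^esub> dual C x)"

text \<open>
  In \<^verbatim>\<open>transposes_agree\<close> the equation with \<^verbatim>\<open>lev\<close> says that \<^verbatim>\<open>h\<close> is the left transpose of \<^verbatim>\<open>f\<close>,
  the one with \<^verbatim>\<open>rev\<close> that it is the right transpose. Similarly \<^verbatim>\<open>h\<close> in \<^verbatim>\<open>dual_tensor_agree\<close> and
  \<^verbatim>\<open>dual_unit_agree\<close> is the structure morphism of the left, respectively right, dual functor.
\<close>

locale pivotal_linear_category = monoidal_linear_category C
  for C :: "('o, 'm::ab_group_add, 'x) pivotal_cat_scheme" (structure) +
  assumes dual_in_Ob: "x \<in> Ob C \<Longrightarrow> dual C x \<in> Ob C"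
    and lev_in_Hom: "x \<in> Ob C \<Longrightarrow> lev C x \<in> Hom C (dual C x \<boxtimes> x) \<I>"
    and lcoev_in_Hom: "x \<in> Ob C \<Longrightarrow> lcoev C x \<in> Hom C \<I> (x \<boxtimes> dual C x)"
    and rev_in_Hom: "x \<in> Ob C \<Longrightarrow> rev C x \<in> Hom C (x \<boxtimes> dual C x) \<I>"
    and rcoev_in_Hom: "x \<in> Ob C \<Longrightarrow> rcoev C x \<in> Hom C \<I> (dual C x \<boxtimes> x)"
    and left_snake:
      "x \<in> Ob C \<Longrightarrow>
        run C x \<bullet> (idt C x \<star> lev C x) \<bullet> asc C x (dual C x) x \<bullet> (lcoev C x \<star> idt C x)
        = lun C x"
    and left_snake_dual:
      "x \<in> Ob C \<Longrightarrow>
        lun C (dual C x) \<bullet> (lev C x \<star> idt C (dual C x)) \<bullet> asc_inv C (dual C x) x (dual C x)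
          \<bullet> (idt C (dual C x) \<star> lcoev C x)
        = run C (dual C x)"
    and right_snake:
      "x \<in> Ob C \<Longrightarrow>
        lun C x \<bullet> (rev C x \<star> idt C x) \<bullet> asc_inv C x (dual C x) x \<bullet> (idt C x \<star> rcoev C x)
        = run C x"
    and right_snake_dual:
      "x \<in> Ob C \<Longrightarrow>
        run C (dual C x) \<bullet> (idt C (dual C x) \<star> rev C x) \<bullet> asc C (dual C x) x (dual C x)
          \<bullet> (rcoev C x \<star> idt C (dual C x))
        = lun C (dual C x)"
    and transposes_agree:
      "\<lbrakk>x \<in> Ob C; y \<in> Ob C; f \<in> Hom C x y; h \<in> Hom C (dual C y) (dual C x);
        lev C x \<bullet> (h \<star> idt C x) = lev C y \<bullet> (idt C (dual C y) \<star> f)\<rbrakk>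
        \<Longrightarrow> rev C x \<bullet> (idt C x \<star> h) = rev C y \<bullet> (f \<star> idt C (dual C y))"
    and dual_tensor_agree:
      "\<lbrakk>x \<in> Ob C; y \<in> Ob C; h \<in> Hom C (dual C y \<boxtimes> dual C x) (dual C (x \<boxtimes> y));
        lev C (x \<boxtimes> y) \<bullet> (h \<star> idt C (x \<boxtimes> y)) = nested_lev C x y\<rbrakk>
        \<Longrightarrow> rev C (x \<boxtimes> y) \<bullet> (idt C (x \<boxtimes> y) \<star> h) = nested_rev C x y"
    and dual_unit_agree:
      "\<lbrakk>h \<in> Hom C \<I> (dual C \<I>); lev C \<I> \<bullet> (h \<star> idt C \<I>) = lun C \<I>\<rbrakk>
        \<Longrightarrow> rev C \<I> \<bullet> (idt C \<I> \<star> h) = lun C \<I>"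

definition unit_scalar :: "('o, 'm, 'x) monoidal_cat_scheme \<Rightarrow> 'm \<Rightarrow> complex" where
  "unit_scalar C f = (THE t. f = scal C t (idt C (\<I>\<^bsub>C\<^esub>)))"

definition trace :: "('o, 'm, 'x) pivotal_cat_scheme \<Rightarrow> 'o \<Rightarrow> 'm \<Rightarrow> complex" where
  "trace C x f =
    unit_scalar C (rev C x \<bullet>\<^bsub>C\<^esub> (f \<star>\<^bsub>C\<^esub> idt C (dual C x)) \<bullet>\<^bsub>C\<^esub> lcoev C x)"

definition qdim :: "('o, 'm, 'x) pivotal_cat_scheme \<Rightarrow> 'o \<Rightarrow> complex" where
  "qdim C x = trace C x (idt C x)"

locale spherical_fusion_category = pivotal_linear_category C
  for C :: "('o, 'm::ab_group_add, 'x) pivotal_cat_scheme" (structure) +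
  assumes direct_sums_exist:
      "(\<And>j. j < (n::nat) \<Longrightarrow> X j \<in> Ob C) \<Longrightarrow> \<exists>s \<iota> \<pi>. direct_sum C {..<n} X s \<iota> \<pi>"
    and finitely_semisimple: "\<exists>I. finite I \<and> simple_representatives C I"
    and unit_simple: "simple_object C \<I>"
    and spherical:
      "\<lbrakk>x \<in> Ob C; f \<in> Hom C x x\<rbrakk> \<Longrightarrow>
        rev C x \<bullet> (f \<star> idt C (dual C x)) \<bullet> lcoev C x
        = lev C x \<bullet> (idt C (dual C x) \<star> f) \<bullet> rcoev C x"


section \<open>Modular tensor categories\<close>

record ('o, 'm) braided_cat = "('o, 'm) pivotal_cat" +
  braid :: "'o \<Rightarrow> 'o \<Rightarrow> 'm"

locale braided_spherical_fusion_category = spherical_fusion_category C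
  for C :: "('o, 'm::ab_group_add, 'x) braided_cat_scheme" (structure) +
  assumes braid_iso:
      "\<lbrakk>x \<in> Ob C; y \<in> Ob C\<rbrakk> \<Longrightarrow> iso_in C (x \<boxtimes> y) (y \<boxtimes> x) (braid C x y)"
    and braid_natural:
      "\<lbrakk>x \<in> Ob C; y \<in> Ob C; x' \<in> Ob C; y' \<in> Ob C; f \<in> Hom C x x'; h \<in> Hom C y y'\<rbrakk>
        \<Longrightarrow> braid C x' y' \<bullet> (f \<star> h) = (h \<star> f) \<bullet> braid C x y"
    and hexagon_right:
      "\<lbrakk>x \<in> Ob C; y \<in> Ob C; z \<in> Ob C\<rbrakk>
        \<Longrightarrow> asc C y z x \<bullet> braid C x (y \<boxtimes> z) \<bullet> asc C x y z
            = (idt C y \<star> braid C x z) \<bullet> asc C y x z \<bullet> (braid C x y \<star> idt C z)"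
    and hexagon_left:
      "\<lbrakk>x \<in> Ob C; y \<in> Ob C; z \<in> Ob C\<rbrakk>
        \<Longrightarrow> asc_inv C z x y \<bullet> braid C (x \<boxtimes> y) z \<bullet> asc_inv C x y z
            = (braid C x z \<star> idt C y) \<bullet> asc_inv C x z y \<bullet> (idt C x \<star> braid C y z)"

definition S_entry :: "('o, 'm, 'x) braided_cat_scheme \<Rightarrow> 'o \<Rightarrow> 'o \<Rightarrow> complex" where
  "S_entry C x y = trace C (x \<boxtimes>\<^bsub>C\<^esub> y) (braid C y x \<bullet>\<^bsub>C\<^esub> braid C x y)"

locale modular_category = braided_spherical_fusion_category C
  for C :: "('o, 'm::ab_group_add, 'x) braided_cat_scheme" (structure) +
  assumes S_nondegenerate:
    "\<lbrakk>finite I; simple_representatives C I; \<And>x. x \<in> I \<Longrightarrow> (\<Sum>y\<in>I. S_entry C x y * \<phi> y) = 0; y \<in> I\<rbrakk>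
      \<Longrightarrow> \<phi> y = 0"

text \<open>
  A TQFT is a modular category together with a sign \<^verbatim>\<open>s\<close>, which stands for the choice
  \<^verbatim>\<open>D = s * sqrt (\<Sum>a. d_a\<^sup>2)\<close>.
\<close>

definition tqft :: "('o, 'm::ab_group_add) braided_cat \<times> int \<Rightarrow> bool" where
  "tqft \<T> \<longleftrightarrow> modular_category (fst \<T>) \<and> snd \<T> \<in> {1, -1}"


section \<open>Description by \<open>F\<close> symbols, \<open>R\<close> symbols and pivotal coefficients\<close>

text \<open>
  The last two arguments of \<^verbatim>\<open>Fsym\<close> are a row \<^verbatim>\<open>(e, \<alpha>, \<beta>)\<close> and a column \<^verbatim>\<open>(f, \<mu>, \<nu>)\<close> of the
  matrix \<^verbatim>\<open>F\<close> of \<^verbatim>\<open>(a \<boxtimes> b) \<boxtimes> c \<rightarrow> d\<close>; Greek letters number basis vectors of fusion spaces. Only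
  admissible indices carry information.
\<close>

record 'a mtc_data =
  labels :: "'a set"
  vac :: "'a"
  bar :: "'a \<Rightarrow> 'a"
  fus :: "'a \<Rightarrow> 'a \<Rightarrow> 'a \<Rightarrow> nat"
  Fsym :: "'a \<Rightarrow> 'a \<Rightarrow> 'a \<Rightarrow> 'a \<Rightarrow> 'a \<times> nat \<times> nat \<Rightarrow> 'a \<times> nat \<times> nat \<Rightarrow> complex"
  Rsym :: "'a \<Rightarrow> 'a \<Rightarrow> 'a \<Rightarrow> nat \<Rightarrow> nat \<Rightarrow> complex"
  eps :: "'a \<Rightarrow> int"

definition left_channels :: "'a mtc_data \<Rightarrow> 'a \<Rightarrow> 'a \<Rightarrow> 'a \<Rightarrow> 'a \<Rightarrow> ('a \<times> nat \<times> nat) set" where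
  "left_channels A a b c d =
    {(e, \<alpha>, \<beta>). e \<in> labels A \<and> \<alpha> < fus A a b e \<and> \<beta> < fus A e c d}"

definition right_channels :: "'a mtc_data \<Rightarrow> 'a \<Rightarrow> 'a \<Rightarrow> 'a \<Rightarrow> 'a \<Rightarrow> ('a \<times> nat \<times> nat) set" where
  "right_channels A a b c d =
    {(f, \<mu>, \<nu>). f \<in> labels A \<and> \<mu> < fus A b c f \<and> \<nu> < fus A a f d}"

text \<open>
  \<^verbatim>\<open>X a\<close> is the simple object labelled \<^verbatim>\<open>a\<close>, and \<^verbatim>\<open>v a b c \<mu>\<close> for \<^verbatim>\<open>\<mu> < fus A a b c\<close> is the chosen
  basis of \<^verbatim>\<open>V_ab^c = Hom (X a \<boxtimes> X b) (X c)\<close>. As usual the basis vectors with a trivial label are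
  the unit constraints (so \<^verbatim>\<open>F\<close> with a trivial upper label is an identity matrix), and the pivotal
  coefficients are normalised by \<^verbatim>\<open>d_a = \<epsilon>_a / [F^(a,bar a,a)_a]_(1,1)\<close>; they are signs, which is a
  condition on the bases of the spaces \<^verbatim>\<open>V_(a,bar a)^1\<close>.
\<close>

definition gauge_presentation ::
  "('o, 'm::ab_group_add, 'x) braided_cat_scheme \<Rightarrow> 'a mtc_data \<Rightarrow> ('a \<Rightarrow> 'o)
    \<Rightarrow> ('a \<Rightarrow> 'a \<Rightarrow> 'a \<Rightarrow> nat \<Rightarrow> 'm) \<Rightarrow> bool" where
  "gauge_presentation C A X v \<longleftrightarrow>
    finite (labels A) \<and> vac A \<in> labels A \<and> bar A ` labels A \<subseteq> labels A \<and>
    inj_on X (labels A) \<and> simple_representatives C (X ` labels A) \<and>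
    X (vac A) = \<I>\<^bsub>C\<^esub> \<and>
    (\<forall>a\<in>labels A. isomorphic_in C (X (bar A a)) (dual C (X a))) \<and>
    (\<forall>a\<in>labels A. \<forall>b\<in>labels A. \<forall>c\<in>labels A.
      inj_on (v a b c) {..<fus A a b c} \<and>
      \<not> Modules.module.dependent (scal C) (v a b c ` {..<fus A a b c}) \<and>
      Modules.module.span (scal C) (v a b c ` {..<fus A a b c})
        = Hom C (X a \<boxtimes>\<^bsub>C\<^esub> X b) (X c)) \<and>
    (\<forall>a\<in>labels A. v (vac A) a a 0 = lun C (X a) \<and> v a (vac A) a 0 = run C (X a)) \<and>
    (\<forall>a\<in>labels A. \<forall>b\<in>labels A. \<forall>c\<in>labels A. \<forall>d\<in>labels A.
      \<forall>(e, \<alpha>, \<beta>) \<in> left_channels A a b c d.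
        v e c d \<beta> \<bullet>\<^bsub>C\<^esub> (v a b e \<alpha> \<star>\<^bsub>C\<^esub> idt C (X c)) =
        (\<Sum>(f, \<mu>, \<nu>) \<in> right_channels A a b c d.
          scal C (Fsym A a b c d (e, \<alpha>, \<beta>) (f, \<mu>, \<nu>))
            (v a f d \<nu> \<bullet>\<^bsub>C\<^esub> (idt C (X a) \<star>\<^bsub>C\<^esub> v b c f \<mu>) \<bullet>\<^bsub>C\<^esub> asc C (X a) (X b) (X c)))) \<and>
    (\<forall>a\<in>labels A. \<forall>b\<in>labels A. \<forall>c\<in>labels A. \<forall>\<mu> < fus A b a c.
      v b a c \<mu> \<bullet>\<^bsub>C\<^esub> braid C (X a) (X b) =
      (\<Sum>\<nu> < fus A a b c. scal C (Rsym A a b c \<mu> \<nu>) (v a b c \<nu>))) \<and>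
    (\<forall>a\<in>labels A. eps A a \<in> {1, -1} \<and>
      qdim C (X a) * Fsym A a (bar A a) a a (vac A, 0, 0) (vac A, 0, 0) = of_int (eps A a))"

definition describes ::
  "'a mtc_data \<times> int \<Rightarrow> ('o, 'm::ab_group_add) braided_cat \<times> int \<Rightarrow> bool" where
  "describes T \<T> \<longleftrightarrow>
    (\<exists>X v. gauge_presentation (fst \<T>) (fst T) X v) \<and> snd T = snd \<T>"

text \<open>
  The type argument fixes the universe (types of objects and arrows) in which the category lives.
\<close>

definition is_tqft :: "('o \<times> 'm::ab_group_add) itself \<Rightarrow> 'a mtc_data \<times> int \<Rightarrow> bool" where
  "is_tqft U T \<longleftrightarrow> (\<exists>\<T> :: ('o, 'm) braided_cat \<times> int. tqft \<T> \<and> describes T \<T>)"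


section \<open>Gauging\<close>

text \<open>
  \<^verbatim>\<open>deg g\<close> is the graded component of \<^verbatim>\<open>g\<close>; \<^verbatim>\<open>acto g\<close> and \<^verbatim>\<open>actm g\<close> are the functor by which \<^verbatim>\<open>g\<close>
  acts. The structure morphisms of the action point in the directions
  \<^verbatim>\<open>act_ten g x y : g(x \<boxtimes> y) \<rightarrow> g(x) \<boxtimes> g(y)\<close>, \<^verbatim>\<open>act_unit g : g(\<I>) \<rightarrow> \<I>\<close>,
  \<^verbatim>\<open>act_comp g h x : g(h(x)) \<rightarrow> (gh)(x)\<close> and \<^verbatim>\<open>act_one x : e(x) \<rightarrow> x\<close>, and
  \<^verbatim>\<open>gbraid g x y : x \<boxtimes> y \<rightarrow> g(y) \<boxtimes> x\<close> is the crossed braiding, for \<^verbatim>\<open>x\<close> of degree \<^verbatim>\<open>g\<close>.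
\<close>

record ('o, 'm, 'g) gcrossed_cat = "('o, 'm) pivotal_cat" +
  deg :: "'g \<Rightarrow> 'o set"
  acto :: "'g \<Rightarrow> 'o \<Rightarrow> 'o"
  actm :: "'g \<Rightarrow> 'm \<Rightarrow> 'm"
  act_ten :: "'g \<Rightarrow> 'o \<Rightarrow> 'o \<Rightarrow> 'm"
  act_unit :: "'g \<Rightarrow> 'm"
  act_comp :: "'g \<Rightarrow> 'g \<Rightarrow> 'o \<Rightarrow> 'm"
  act_one :: "'o \<Rightarrow> 'm"
  gbraid :: "'g \<Rightarrow> 'o \<Rightarrow> 'o \<Rightarrow> 'm"

locale faithfully_graded_category = spherical_fusion_category D
  for G :: "('g, 'z) monoid_scheme"
    and D :: "('o, 'm::ab_group_add, 'g, 'x) gcrossed_cat_scheme" (structure) +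
  assumes deg_Ob: "g \<in> carrier G \<Longrightarrow> deg D g \<subseteq> Ob D"
    and deg_replete:
      "\<lbrakk>g \<in> carrier G; x \<in> deg D g; y \<in> Ob D; isomorphic_in D x y\<rbrakk> \<Longrightarrow> y \<in> deg D g"
    and deg_orthogonal:
      "\<lbrakk>g \<in> carrier G; h \<in> carrier G; g \<noteq> h; x \<in> deg D g; y \<in> deg D h\<rbrakk> \<Longrightarrow> Hom D x y = {0}"
    and deg_decomposition:
      "s \<in> Ob D \<Longrightarrow>
        \<exists>X \<iota> \<pi>. (\<forall>g\<in>carrier G. X g \<in> deg D g) \<and> direct_sum D (carrier G) X s \<iota> \<pi>"
    and deg_unit: "\<I> \<in> deg D (\<one>\<^bsub>G\<^esub>)"
    and deg_tensor:
      "\<lbrakk>g \<in> carrier G; h \<in> carrier G; x \<in> deg D g; y \<in> deg D h\<rbrakk>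
        \<Longrightarrow> x \<boxtimes> y \<in> deg D (g \<otimes>\<^bsub>G\<^esub> h)"
    and deg_faithful: "g \<in> carrier G \<Longrightarrow> \<exists>x\<in>deg D g. idt D x \<noteq> 0"

text \<open>
  An action by monoidal functors. Axiom \<^verbatim>\<open>act_pivotal\<close> makes them pivotal: the comparison
  \<^verbatim>\<open>k : g(x*) \<rightarrow> g(x)*\<close> is the same for left and for right duality.
\<close>

locale action_on_category = spherical_fusion_category D
  for G :: "('g, 'z) monoid_scheme"
    and D :: "('o, 'm::ab_group_add, 'g, 'x) gcrossed_cat_scheme" (structure) +
  assumes acto_in_Ob: "\<lbrakk>g \<in> carrier G; x \<in> Ob D\<rbrakk> \<Longrightarrow> acto D g x \<in> Ob D"
    and actm_in_Hom:
      "\<lbrakk>g \<in> carrier G; x \<in> Ob D; y \<in> Ob D; f \<in> Hom D x y\<rbrakk>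
        \<Longrightarrow> actm D g f \<in> Hom D (acto D g x) (acto D g y)"
    and actm_idt: "\<lbrakk>g \<in> carrier G; x \<in> Ob D\<rbrakk> \<Longrightarrow> actm D g (idt D x) = idt D (acto D g x)"
    and actm_cmp:
      "\<lbrakk>g \<in> carrier G; x \<in> Ob D; y \<in> Ob D; z \<in> Ob D; f \<in> Hom D x y; f' \<in> Hom D y z\<rbrakk>
        \<Longrightarrow> actm D g (f' \<bullet> f) = actm D g f' \<bullet> actm D g f"
    and actm_add:
      "\<lbrakk>g \<in> carrier G; x \<in> Ob D; y \<in> Ob D; f \<in> Hom D x y; f' \<in> Hom D x y\<rbrakk>
        \<Longrightarrow> actm D g (f + f') = actm D g f + actm D g f'"
    and actm_scal:
      "\<lbrakk>g \<in> carrier G; x \<in> Ob D; y \<in> Ob D; f \<in> Hom D x y\<rbrakk>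
        \<Longrightarrow> actm D g (scal D t f) = scal D t (actm D g f)"
    and act_ten_iso:
      "\<lbrakk>g \<in> carrier G; x \<in> Ob D; y \<in> Ob D\<rbrakk>
        \<Longrightarrow> iso_in D (acto D g (x \<boxtimes> y)) (acto D g x \<boxtimes> acto D g y) (act_ten D g x y)"
    and act_ten_natural:
      "\<lbrakk>g \<in> carrier G; x \<in> Ob D; y \<in> Ob D; x' \<in> Ob D; y' \<in> Ob D;
        f \<in> Hom D x x'; f' \<in> Hom D y y'\<rbrakk>
        \<Longrightarrow> act_ten D g x' y' \<bullet> actm D g (f \<star> f')
            = (actm D g f \<star> actm D g f') \<bullet> act_ten D g x y"
    and act_unit_iso: "g \<in> carrier G \<Longrightarrow> iso_in D (acto D g \<I>) \<I> (act_unit D g)"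
    and act_ten_asc:
      "\<lbrakk>g \<in> carrier G; x \<in> Ob D; y \<in> Ob D; z \<in> Ob D\<rbrakk>
        \<Longrightarrow> (idt D (acto D g x) \<star> act_ten D g y z) \<bullet> act_ten D g x (y \<boxtimes> z)
              \<bullet> actm D g (asc D x y z)
            = asc D (acto D g x) (acto D g y) (acto D g z)
              \<bullet> (act_ten D g x y \<star> idt D (acto D g z)) \<bullet> act_ten D g (x \<boxtimes> y) z"
    and act_ten_lun:
      "\<lbrakk>g \<in> carrier G; x \<in> Ob D\<rbrakk>
        \<Longrightarrow> lun D (acto D g x) \<bullet> (act_unit D g \<star> idt D (acto D g x)) \<bullet> act_ten D g \<I> x
            = actm D g (lun D x)"
    and act_ten_run:
      "\<lbrakk>g \<in> carrier G; x \<in> Ob D\<rbrakk>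
        \<Longrightarrow> run D (acto D g x) \<bullet> (idt D (acto D g x) \<star> act_unit D g) \<bullet> act_ten D g x \<I>
            = actm D g (run D x)"
    and act_comp_iso:
      "\<lbrakk>g \<in> carrier G; h \<in> carrier G; x \<in> Ob D\<rbrakk>
        \<Longrightarrow> iso_in D (acto D g (acto D h x)) (acto D (g \<otimes>\<^bsub>G\<^esub> h) x) (act_comp D g h x)"
    and act_comp_natural:
      "\<lbrakk>g \<in> carrier G; h \<in> carrier G; x \<in> Ob D; y \<in> Ob D; f \<in> Hom D x y\<rbrakk>
        \<Longrightarrow> act_comp D g h y \<bullet> actm D g (actm D h f)
            = actm D (g \<otimes>\<^bsub>G\<^esub> h) f \<bullet> act_comp D g h x"
    and act_comp_ten:
      "\<lbrakk>g \<in> carrier G; h \<in> carrier G; x \<in> Ob D; y \<in> Ob D\<rbrakk>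
        \<Longrightarrow> act_ten D (g \<otimes>\<^bsub>G\<^esub> h) x y \<bullet> act_comp D g h (x \<boxtimes> y)
            = (act_comp D g h x \<star> act_comp D g h y)
              \<bullet> act_ten D g (acto D h x) (acto D h y) \<bullet> actm D g (act_ten D h x y)"
    and act_comp_unit:
      "\<lbrakk>g \<in> carrier G; h \<in> carrier G\<rbrakk>
        \<Longrightarrow> act_unit D (g \<otimes>\<^bsub>G\<^esub> h) \<bullet> act_comp D g h \<I>
            = act_unit D g \<bullet> actm D g (act_unit D h)"
    and act_comp_assoc:
      "\<lbrakk>g \<in> carrier G; h \<in> carrier G; k \<in> carrier G; x \<in> Ob D\<rbrakk>
        \<Longrightarrow> act_comp D (g \<otimes>\<^bsub>G\<^esub> h) k x \<bullet> act_comp D g h (acto D k x)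
            = act_comp D g (h \<otimes>\<^bsub>G\<^esub> k) x \<bullet> actm D g (act_comp D h k x)"
    and act_one_iso: "x \<in> Ob D \<Longrightarrow> iso_in D (acto D (\<one>\<^bsub>G\<^esub>) x) x (act_one D x)"
    and act_one_natural:
      "\<lbrakk>x \<in> Ob D; y \<in> Ob D; f \<in> Hom D x y\<rbrakk>
        \<Longrightarrow> act_one D y \<bullet> actm D (\<one>\<^bsub>G\<^esub>) f = f \<bullet> act_one D x"
    and act_one_ten:
      "\<lbrakk>x \<in> Ob D; y \<in> Ob D\<rbrakk>
        \<Longrightarrow> act_one D (x \<boxtimes> y) = (act_one D x \<star> act_one D y) \<bullet> act_ten D (\<one>\<^bsub>G\<^esub>) x y"
    and act_one_unit: "act_one D \<I> = act_unit D (\<one>\<^bsub>G\<^esub>)"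
    and act_comp_one_left:
      "\<lbrakk>g \<in> carrier G; x \<in> Ob D\<rbrakk> \<Longrightarrow> act_comp D (\<one>\<^bsub>G\<^esub>) g x = act_one D (acto D g x)"
    and act_comp_one_right:
      "\<lbrakk>g \<in> carrier G; x \<in> Ob D\<rbrakk> \<Longrightarrow> act_comp D g (\<one>\<^bsub>G\<^esub>) x = actm D g (act_one D x)"
    and act_pivotal:
      "\<lbrakk>g \<in> carrier G; x \<in> Ob D\<rbrakk>
        \<Longrightarrow> \<exists>k. iso_in D (acto D g (dual D x)) (dual D (acto D g x)) k \<and>
              lev D (acto D g x) \<bullet> (k \<star> idt D (acto D g x)) \<bullet> act_ten D g (dual D x) x
                = act_unit D g \<bullet> actm D g (lev D x) \<and>
              rev D (acto D g x) \<bullet> (idt D (acto D g x) \<star> k) \<bullet> act_ten D g x (dual D x)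
                = act_unit D g \<bullet> actm D g (rev D x)"

locale gcrossed_braided_category =
    faithfully_graded_category G D + action_on_category G D
  for G :: "('g, 'z) monoid_scheme"
    and D :: "('o, 'm::ab_group_add, 'g, 'x) gcrossed_cat_scheme" (structure) +
  assumes act_deg:
      "\<lbrakk>g \<in> carrier G; h \<in> carrier G; x \<in> deg D h\<rbrakk>
        \<Longrightarrow> acto D g x \<in> deg D (g \<otimes>\<^bsub>G\<^esub> h \<otimes>\<^bsub>G\<^esub> inv\<^bsub>G\<^esub> g)"
    and gbraid_iso:
      "\<lbrakk>g \<in> carrier G; x \<in> deg D g; y \<in> Ob D\<rbrakk>
        \<Longrightarrow> iso_in D (x \<boxtimes> y) (acto D g y \<boxtimes> x) (gbraid D g x y)"
    and gbraid_natural: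
      "\<lbrakk>g \<in> carrier G; x \<in> deg D g; x' \<in> deg D g; y \<in> Ob D; y' \<in> Ob D;
        f \<in> Hom D x x'; f' \<in> Hom D y y'\<rbrakk>
        \<Longrightarrow> gbraid D g x' y' \<bullet> (f \<star> f') = (actm D g f' \<star> f) \<bullet> gbraid D g x y"
    and gbraid_equivariant:
      "\<lbrakk>g \<in> carrier G; h \<in> carrier G; x \<in> deg D h; y \<in> Ob D\<rbrakk>
        \<Longrightarrow> (act_comp D g h y \<star> idt D (acto D g x)) \<bullet> act_ten D g (acto D h y) x
              \<bullet> actm D g (gbraid D h x y)
            = (act_comp D (g \<otimes>\<^bsub>G\<^esub> h \<otimes>\<^bsub>G\<^esub> inv\<^bsub>G\<^esub> g) g y \<star> idt D (acto D g x))
              \<bullet> gbraid D (g \<otimes>\<^bsub>G\<^esub> h \<otimes>\<^bsub>G\<^esub> inv\<^bsub>G\<^esub> g) (acto D g x) (acto D g y)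
              \<bullet> act_ten D g x y"
    and gbraid_heptagon_right:
      "\<lbrakk>g \<in> carrier G; x \<in> deg D g; y \<in> Ob D; z \<in> Ob D\<rbrakk>
        \<Longrightarrow> asc D (acto D g y) (acto D g z) x \<bullet> (act_ten D g y z \<star> idt D x)
              \<bullet> gbraid D g x (y \<boxtimes> z) \<bullet> asc D x y z
            = (idt D (acto D g y) \<star> gbraid D g x z) \<bullet> asc D (acto D g y) x z
              \<bullet> (gbraid D g x y \<star> idt D z)"
    and gbraid_heptagon_left:
      "\<lbrakk>g \<in> carrier G; h \<in> carrier G; x \<in> deg D g; y \<in> deg D h; z \<in> Ob D\<rbrakk>
        \<Longrightarrow> gbraid D (g \<otimes>\<^bsub>G\<^esub> h) (x \<boxtimes> y) z
            = asc D (acto D (g \<otimes>\<^bsub>G\<^esub> h) z) x y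
              \<bullet> ((act_comp D g h z \<star> idt D x) \<star> idt D y)
              \<bullet> (gbraid D g x (acto D h z) \<star> idt D y)
              \<bullet> asc_inv D x (acto D h z) y \<bullet> (idt D x \<star> gbraid D h y z) \<bullet> asc D x y z"

definition trivial_component ::
  "('g, 'z) monoid_scheme \<Rightarrow> ('o, 'm, 'g, 'x) gcrossed_cat_scheme \<Rightarrow> ('o, 'm) braided_cat" where
  "trivial_component G D =
    \<lparr>Ob = deg D (\<one>\<^bsub>G\<^esub>), Hom = Hom D, idt = idt D, cmp = cmp D, scal = scal D,
     tob = tob D, tar = tar D, unit_ob = unit_ob D, asc = asc D, lun = lun D, run = run D,
     dual = dual D, lev = lev D, lcoev = lcoev D, rev = rev D, rcoev = rcoev D,
     braid = (\<lambda>x y. (act_one D y \<star>\<^bsub>D\<^esub> idt D x) \<bullet>\<^bsub>D\<^esub> gbraid D (\<one>\<^bsub>G\<^esub>) x y)\<rparr>"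

definition equivariant_objects ::
  "('g, 'z) monoid_scheme \<Rightarrow> ('o, 'm, 'g, 'x) gcrossed_cat_scheme \<Rightarrow> ('o \<times> ('g \<Rightarrow> 'm)) set" where
  "equivariant_objects G D =
    {(x, u). x \<in> Ob D \<and> u \<in> extensional (carrier G) \<and>
      (\<forall>g\<in>carrier G. iso_in D (acto D g x) x (u g)) \<and>
      (\<forall>g\<in>carrier G. \<forall>h\<in>carrier G.
        u (g \<otimes>\<^bsub>G\<^esub> h) \<bullet>\<^bsub>D\<^esub> act_comp D g h x = u g \<bullet>\<^bsub>D\<^esub> actm D g (u h))}"

definition equivariant_maps ::
  "('g, 'z) monoid_scheme \<Rightarrow> ('o, 'm, 'g, 'x) gcrossed_cat_scheme
    \<Rightarrow> 'o \<times> ('g \<Rightarrow> 'm) \<Rightarrow> 'o \<times> ('g \<Rightarrow> 'm) \<Rightarrow> 'm set" where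
  "equivariant_maps G D x y =
    {f \<in> Hom D (fst x) (fst y). \<forall>g\<in>carrier G. f \<bullet>\<^bsub>D\<^esub> snd x g = snd y g \<bullet>\<^bsub>D\<^esub> actm D g f}"

definition equivariant_tensor ::
  "('g, 'z) monoid_scheme \<Rightarrow> ('o, 'm, 'g, 'x) gcrossed_cat_scheme
    \<Rightarrow> 'o \<times> ('g \<Rightarrow> 'm) \<Rightarrow> 'o \<times> ('g \<Rightarrow> 'm) \<Rightarrow> 'o \<times> ('g \<Rightarrow> 'm)" where
  "equivariant_tensor G D x y =
    (fst x \<boxtimes>\<^bsub>D\<^esub> fst y,
     \<lambda>g\<in>carrier G. (snd x g \<star>\<^bsub>D\<^esub> snd y g) \<bullet>\<^bsub>D\<^esub> act_ten D g (fst x) (fst y))"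

text \<open>
  The equivariant structure of the dual of \<^verbatim>\<open>(x, u)\<close> is the unique one for which \<^verbatim>\<open>lev D x\<close> is
  equivariant.
\<close>

definition equivariant_dual ::
  "('g, 'z) monoid_scheme \<Rightarrow> ('o, 'm, 'g, 'x) gcrossed_cat_scheme
    \<Rightarrow> 'o \<times> ('g \<Rightarrow> 'm) \<Rightarrow> 'o \<times> ('g \<Rightarrow> 'm)" where
  "equivariant_dual G D x =
    (dual D (fst x),
     \<lambda>g\<in>carrier G. THE w. w \<in> Hom D (acto D g (dual D (fst x))) (dual D (fst x)) \<and>
       lev D (fst x) \<bullet>\<^bsub>D\<^esub> (w \<star>\<^bsub>D\<^esub> snd x g) \<bullet>\<^bsub>D\<^esub> act_ten D g (dual D (fst x)) (fst x)
       = act_unit D g \<bullet>\<^bsub>D\<^esub> actm D g (lev D (fst x)))"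

text \<open>
  On the degree \<^verbatim>\<open>g\<close> part \<^verbatim>\<open>z\<close> of \<^verbatim>\<open>x\<close>, the braiding of \<^verbatim>\<open>(x, u)\<close> and \<^verbatim>\<open>(y, w)\<close> is
  \<^verbatim>\<open>z \<boxtimes> y \<rightarrow> g(y) \<boxtimes> z \<rightarrow> y \<boxtimes> z\<close>, the crossed braiding followed by \<^verbatim>\<open>w g\<close>. It is determined by
  this because \<^verbatim>\<open>x\<close> is the direct sum of its homogeneous parts.
\<close>

definition equivariant_braid ::
  "('g, 'z) monoid_scheme \<Rightarrow> ('o, 'm, 'g, 'x) gcrossed_cat_scheme
    \<Rightarrow> 'o \<times> ('g \<Rightarrow> 'm) \<Rightarrow> 'o \<times> ('g \<Rightarrow> 'm) \<Rightarrow> 'm" where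
  "equivariant_braid G D x y =
    (THE b. b \<in> Hom D (fst x \<boxtimes>\<^bsub>D\<^esub> fst y) (fst y \<boxtimes>\<^bsub>D\<^esub> fst x) \<and>
      (\<forall>g\<in>carrier G. \<forall>z\<in>deg D g. \<forall>\<iota>\<in>Hom D z (fst x).
        b \<bullet>\<^bsub>D\<^esub> (\<iota> \<star>\<^bsub>D\<^esub> idt D (fst y))
        = (idt D (fst y) \<star>\<^bsub>D\<^esub> \<iota>) \<bullet>\<^bsub>D\<^esub> (snd y g \<star>\<^bsub>D\<^esub> idt D z) \<bullet>\<^bsub>D\<^esub> gbraid D g z (fst y)))"

definition equivariantization ::
  "('g, 'z) monoid_scheme \<Rightarrow> ('o, 'm, 'g, 'x) gcrossed_cat_scheme
    \<Rightarrow> ('o \<times> ('g \<Rightarrow> 'm), 'm) braided_cat" where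
  "equivariantization G D =
    \<lparr>Ob = equivariant_objects G D, Hom = equivariant_maps G D,
     idt = (\<lambda>x. idt D (fst x)), cmp = cmp D, scal = scal D,
     tob = equivariant_tensor G D, tar = tar D,
     unit_ob = (\<I>\<^bsub>D\<^esub>, restrict (act_unit D) (carrier G)),
     asc = (\<lambda>x y z. asc D (fst x) (fst y) (fst z)),
     lun = (\<lambda>x. lun D (fst x)), run = (\<lambda>x. run D (fst x)),
     dual = equivariant_dual G D,
     lev = (\<lambda>x. lev D (fst x)), lcoev = (\<lambda>x. lcoev D (fst x)),
     rev = (\<lambda>x. rev D (fst x)), rcoev = (\<lambda>x. rcoev D (fst x)),
     braid = equivariant_braid G D\<rparr>"

text \<open>
  Gauging multiplies the total dimension \<^verbatim>\<open>D\<close> by the order of the group, so it keeps the sign.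
\<close>

definition gauged_theory ::
  "('g, 'z) monoid_scheme \<Rightarrow> ('o, 'm) braided_cat \<times> int \<Rightarrow> ('o, 'm, 'g) gcrossed_cat
    \<Rightarrow> ('o \<times> ('g \<Rightarrow> 'm), 'm) braided_cat \<times> int" where
  "gauged_theory G \<T>\<^sub>0 D = (equivariantization G D, snd \<T>\<^sub>0)"

text \<open>
  The symmetry of the theory \<^verbatim>\<open>\<T>\<^sub>0\<close> is the action on the trivial component that is part of \<^verbatim>\<open>D\<close>.
\<close>

definition obtained_by_gauging ::
  "('o \<times> 'm::ab_group_add) itself \<Rightarrow> ('g, 'z) monoid_scheme \<Rightarrow> 'a mtc_data \<times> int \<Rightarrow> bool" where
  "obtained_by_gauging U G T \<longleftrightarrow>
    (\<exists>(\<T>\<^sub>0 :: ('o, 'm) braided_cat \<times> int) (D :: ('o, 'm, 'g) gcrossed_cat).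
      tqft \<T>\<^sub>0 \<and> gcrossed_braided_category G D \<and> trivial_component G D = fst \<T>\<^sub>0 \<and>
      tqft (gauged_theory G \<T>\<^sub>0 D) \<and> describes T (gauged_theory G \<T>\<^sub>0 D))"


section \<open>Galois conjugation\<close>

definition complex_field :: "complex ring" where
  "complex_field = \<lparr>carrier = UNIV, monoid.mult = (*), one = 1, zero = 0, add = (+)\<rparr>"

definition number_field :: "complex set \<Rightarrow> bool" where
  "number_field K \<longleftrightarrow> subfield K complex_field \<and> ring.finite_dimension complex_field \<rat> K"

definition normal_over_rat :: "complex set \<Rightarrow> bool" where
  "normal_over_rat L \<longleftrightarrow>
    subfield L complex_field \<and> (\<forall>x\<in>L. algebraic x) \<and>
    (\<forall>p :: rat poly. irreducible p \<and> (\<exists>x\<in>L. poly (map_poly of_rat p) x = 0) \<longrightarrow>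
      {z :: complex. poly (map_poly of_rat p) z = 0} \<subseteq> L)"

definition normal_closure :: "complex set \<Rightarrow> complex set" where
  "normal_closure K = \<Inter>{L. normal_over_rat L \<and> K \<subseteq> L}"

definition Gal :: "complex set \<Rightarrow> (complex \<Rightarrow> complex) set" where
  "Gal K = {q \<in> ring_iso (complex_field\<lparr>carrier := K\<rparr>) (complex_field\<lparr>carrier := K\<rparr>).
    \<forall>x\<in>\<rat>. q x = x}"

definition symbol_entries :: "'a mtc_data \<Rightarrow> complex set" where
  "symbol_entries A =
    {Fsym A a b c d r s | a b c d r s.
      a \<in> labels A \<and> b \<in> labels A \<and> c \<in> labels A \<and> d \<in> labels A \<and>
      r \<in> left_channels A a b c d \<and> s \<in> right_channels A a b c d} \<union>
    {Rsym A a b c \<mu> \<nu> | a b c \<mu> \<nu>.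
      a \<in> labels A \<and> b \<in> labels A \<and> c \<in> labels A \<and> \<mu> < fus A b a c \<and> \<nu> < fus A a b c}"

definition mtc_field :: "'a mtc_data \<Rightarrow> complex set" where
  "mtc_field A = normal_closure (generate_field complex_field (symbol_entries A))"

definition galois_conjugate :: "(complex \<Rightarrow> complex) \<Rightarrow> 'a mtc_data \<Rightarrow> 'a mtc_data" where
  "galois_conjugate q A =
    A\<lparr>Fsym := (\<lambda>a b c d r s. q (Fsym A a b c d r s)),
      Rsym := (\<lambda>a b c \<mu> \<nu>. q (Rsym A a b c \<mu> \<nu>))\<rparr>"

end

theory Submission
  imports Defs "HOL-Computational_Algebra.Fundamental_Theorem_Algebra"
begin

text \<open>
  Extend \<^verbatim>\<open>q\<close> to an automorphism \<^verbatim>\<open>\<sigma>\<close> of the field of all complex numbers, and let a scalar \<^verbatim>\<open>t\<close>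
  act on the arrows of a category as \<^verbatim>\<open>\<sigma>\<inverse> t\<close> did before. The axioms of modular and of crossed
  braided categories survive this change of complex structure, which commutes with
  equivariantization and with passage to the trivial component and turns every structure constant
  \<^verbatim>\<open>z\<close> into \<^verbatim>\<open>\<sigma> z\<close>. So the twist of the category presented by \<^verbatim>\<open>C\<close> is presented by the conjugate of
  \<^verbatim>\<open>C\<close>, and a gauging of a theory becomes a gauging of the twisted theory.

  To extend \<^verbatim>\<open>q\<close>, fix transcendental elements until the complex numbers are algebraic over its
  domain; then send roots to roots. The resulting endomorphism is onto because its image is
  algebraically closed and the complex numbers are algebraic over it.
\<close>

section \<open>Extending field automorphisms to the complex numbers\<close>

text \<open>
  A partial homomorphism is represented by its graph, which need only be closed under the ring
  operations. It is a function if \<^verbatim>\<open>sends_zero_to_zero\<close> holds for it, and injective if this holds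
  for its converse.
\<close>

definition subring_rel :: "('a::comm_ring_1 \<times> 'b::comm_ring_1) set \<Rightarrow> bool" where
  "subring_rel r \<longleftrightarrow> (1, 1) \<in> r \<and>
    (\<forall>x y x' y'. (x, y) \<in> r \<longrightarrow> (x', y') \<in> r \<longrightarrow> (x - x', y - y') \<in> r \<and> (x * x', y * y') \<in> r)"

definition sends_zero_to_zero :: "('a::zero \<times> 'b::zero) set \<Rightarrow> bool" where
  "sends_zero_to_zero r \<longleftrightarrow> (\<forall>y. (0, y) \<in> r \<longrightarrow> y = 0)"

text \<open>If \<open>r\<close> is the graph of a ring homomorphism, this is the graph of the
  homomorphism that it induces on polynomials.\<close>

definition poly_rel :: "('a::zero \<times> 'b::zero) set \<Rightarrow> ('a poly \<times> 'b poly) set" where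
  "poly_rel r = {(f, g). \<forall>i. (coeff f i, coeff g i) \<in> r}"

text \<open>For a subring relation \<open>r\<close> this is the least subring relation containing
  \<open>r\<close> and \<open>(x, y)\<close>. It can be formed before it is known whether it is
  single-valued.\<close>

definition adjoin ::
  "('a::comm_ring_1 \<times> 'b::comm_ring_1) set \<Rightarrow> 'a \<Rightarrow> 'b \<Rightarrow> ('a \<times> 'b) set" where
  "adjoin r x y = {(poly f x, poly g y) | f g. (f, g) \<in> poly_rel r}"

text \<open>The leading coefficient is arbitrary because \<open>M\<close> is not assumed to be a
  field; over a subring of a domain this is algebraicity over its fraction field.\<close>

definition algebraic_over :: "'a::comm_ring_1 set \<Rightarrow> 'a \<Rightarrow> bool" where
  "algebraic_over M x \<longleftrightarrow> (\<exists>f. f \<noteq> 0 \<and> (\<forall>i. coeff f i \<in> M) \<and> poly f x = 0)"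

section \<open>Arithmetic of subring relations\<close>

lemma subring_rel_one: "subring_rel r \<Longrightarrow> (1, 1) \<in> r"
  and subring_rel_diff:
    "\<lbrakk>subring_rel r; (x, y) \<in> r; (x', y') \<in> r\<rbrakk> \<Longrightarrow> (x - x', y - y') \<in> r"
  and subring_rel_mult:
    "\<lbrakk>subring_rel r; (x, y) \<in> r; (x', y') \<in> r\<rbrakk> \<Longrightarrow> (x * x', y * y') \<in> r"
  unfolding subring_rel_def by blast+

lemma subring_rel_zero: "subring_rel r \<Longrightarrow> (0, 0) \<in> r"
  using subring_rel_diff[OF _ subring_rel_one subring_rel_one, of r] by simp

lemma subring_rel_add:
  assumes "subring_rel r" "(x, y) \<in> r" "(x', y') \<in> r"
  shows "(x + x', y + y') \<in> r"
  using subring_rel_diff[OF assms(1,2) subring_rel_diff[OF assms(1) subring_rel_zero assms(3)]]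
    assms(1) by simp

lemma subring_rel_sum:
  assumes "subring_rel r" "\<And>i. i \<in> A \<Longrightarrow> (f i, g i) \<in> r"
  shows "(sum f A, sum g A) \<in> r"
  using assms(2) by (induction A rule: infinite_finite_induct)
    (auto simp: subring_rel_zero[OF assms(1)] intro: subring_rel_add[OF assms(1)])

lemma subring_rel_converse: "subring_rel (r\<inverse>) \<longleftrightarrow> subring_rel r"
  unfolding subring_rel_def by auto

text \<open>Two pairs from members of a chain both lie in the larger member. This provides the upper
  bounds for Zorn's lemma.\<close>

lemma subring_rel_Union_chain:
  assumes "\<C> \<noteq> {}" "\<And>r s. \<lbrakk>r \<in> \<C>; s \<in> \<C>\<rbrakk> \<Longrightarrow> r \<subseteq> s \<or> s \<subseteq> r"
    "\<And>r. r \<in> \<C> \<Longrightarrow> subring_rel r"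
  shows "subring_rel (\<Union>\<C>)"
proof -
  have "(x - x', y - y') \<in> \<Union>\<C> \<and> (x * x', y * y') \<in> \<Union>\<C>"
    if "(x, y) \<in> \<Union>\<C>" "(x', y') \<in> \<Union>\<C>" for x y x' y'
  proof -
    from that obtain r s where rs: "r \<in> \<C>" "s \<in> \<C>" "(x, y) \<in> r" "(x', y') \<in> s"
      by blast
    with assms(2)[OF rs(1,2)] obtain t where "t \<in> \<C>" "(x, y) \<in> t" "(x', y') \<in> t"
      by blast
    then show ?thesis
      using assms(3) subring_rel_diff subring_rel_mult by blast
  qed
  moreover have "(1, 1) \<in> \<Union>\<C>"
    using assms(1,3) subring_rel_one by blast
  ultimately show ?thesis
    unfolding subring_rel_def by blast
qed

text \<open>Subtracting the two pairs gives \<open>(0, y - y')\<close>, so being single-valued at 0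
  is being single-valued everywhere.\<close>

lemma sends_zero_to_zeroD:
  assumes "subring_rel r" "sends_zero_to_zero r" "(x, y) \<in> r" "(x, y') \<in> r"
  shows "y = y'"
  using subring_rel_diff[OF assms(1,3,4)] assms(2)
  by (metis right_minus_eq sends_zero_to_zero_def)

section \<open>Polynomials with related coefficients\<close>

lemma poly_rel_coeff: "(f, g) \<in> poly_rel r \<Longrightarrow> (coeff f i, coeff g i) \<in> r"
  by (simp add: poly_rel_def)

lemma poly_rel_converse: "poly_rel (r\<inverse>) = (poly_rel r)\<inverse>"
  by (auto simp: poly_rel_def)

lemma poly_rel_diff:
  "\<lbrakk>subring_rel r; (f, g) \<in> poly_rel r; (f', g') \<in> poly_rel r\<rbrakk> \<Longrightarrow> (f - f', g - g') \<in> poly_rel r"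
  by (simp add: poly_rel_def subring_rel_diff)

lemma poly_rel_mult:
  "\<lbrakk>subring_rel r; (f, g) \<in> poly_rel r; (f', g') \<in> poly_rel r\<rbrakk> \<Longrightarrow> (f * f', g * g') \<in> poly_rel r"
  by (simp add: poly_rel_def coeff_mult subring_rel_sum subring_rel_mult)

lemma poly_rel_monom:
  "\<lbrakk>subring_rel r; (a, b) \<in> r\<rbrakk> \<Longrightarrow> (monom a n, monom b n) \<in> poly_rel r"
  by (simp add: poly_rel_def subring_rel_zero)

lemma poly_rel_smult:
  "\<lbrakk>subring_rel r; (a, b) \<in> r; (f, g) \<in> poly_rel r\<rbrakk> \<Longrightarrow> (smult a f, smult b g) \<in> poly_rel r"
  by (simp add: poly_rel_def subring_rel_mult)

lemma poly_rel_exists: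
  assumes "subring_rel r" "\<And>i. coeff f i \<in> Domain r"
  shows "\<exists>g. (f, g) \<in> poly_rel r"
proof -
  obtain b where b: "\<And>i. (coeff f i, b i) \<in> r"
    using choice[of "\<lambda>i y. (coeff f i, y) \<in> r"] assms(2) by blast
  \<comment> \<open>The choice may relate 0 to a nonzero element, so the partners beyond the degree
    are reset to 0; otherwise they need not form a polynomial.\<close>
  define b' where "b' = (\<lambda>i. if i \<le> degree f then b i else 0)"
  have "(coeff f i, b' i) \<in> r" for i
    using b[of i] subring_rel_zero[OF assms(1)] by (auto simp: b'_def coeff_eq_0)
  moreover have "coeff (Abs_poly b') = b'"
    by (rule Abs_poly_inverse) (auto simp: b'_def MOST_nat intro!: exI[of _ "degree f"])
  ultimately show ?thesis
    unfolding poly_rel_def by (intro exI[of _ "Abs_poly b'"]) auto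
qed

lemma poly_rel_zero:
  assumes "sends_zero_to_zero r" "(0, g) \<in> poly_rel r"
  shows "g = 0"
  using assms by (auto simp: poly_rel_def sends_zero_to_zero_def poly_eq_iff)

section \<open>Adjoining a pair of elements to a relation\<close>

lemma adjoinI: "(f, g) \<in> poly_rel r \<Longrightarrow> (poly f x, poly g y) \<in> adjoin r x y"
  by (auto simp: adjoin_def)

lemma adjoin_converse: "adjoin (r\<inverse>) y x = (adjoin r x y)\<inverse>"
  by (auto simp: adjoin_def poly_rel_converse)

text \<open>Applied to \<open>r\<close> and to its converse, this shows that adjoining
  \<open>(x, x)\<close> preserves equality of domain and range.\<close>

lemma Domain_adjoin:
  assumes "subring_rel r"
  shows "Domain (adjoin r x y) = {poly f x | f. \<forall>i. coeff f i \<in> Domain r}"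
proof (intro equalityI subsetI)
  fix a assume "a \<in> Domain (adjoin r x y)"
  then obtain f g where fg: "(f, g) \<in> poly_rel r" "a = poly f x"
    by (auto simp: adjoin_def)
  then have "coeff f i \<in> Domain r" for i
    using poly_rel_coeff by blast
  then show "a \<in> {poly f x | f. \<forall>i. coeff f i \<in> Domain r}"
    using fg(2) by blast
next
  fix a assume "a \<in> {poly f x | f. \<forall>i. coeff f i \<in> Domain r}"
  then obtain f where f: "a = poly f x" "\<And>i. coeff f i \<in> Domain r"
    by blast
  then obtain g where "(f, g) \<in> poly_rel r"
    using poly_rel_exists[OF assms] by blast
  then show "a \<in> Domain (adjoin r x y)"
    using adjoinI f(1) by blast
qed

lemma subset_adjoin:
  assumes "subring_rel r"
  shows "r \<subseteq> adjoin r x y"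
proof (clarify)
  fix a b assume "(a, b) \<in> r"
  from adjoinI[OF poly_rel_monom[OF assms this, of 0], of x y]
  show "(a, b) \<in> adjoin r x y" by (simp add: poly_monom)
qed

lemma in_adjoin: "subring_rel r \<Longrightarrow> (x, y) \<in> adjoin r x y"
  using adjoinI[OF poly_rel_monom[OF _ subring_rel_one, of r 1], of x y]
  by (simp add: poly_monom)

lemma subring_rel_adjoin:
  assumes r: "subring_rel r"
  shows "subring_rel (adjoin r x y)"
  unfolding subring_rel_def
proof (intro conjI allI impI)
  show "(1, 1) \<in> adjoin r x y"
    using subset_adjoin[OF r] subring_rel_one[OF r] by blast
next
  fix a b a' b' assume "(a, b) \<in> adjoin r x y" "(a', b') \<in> adjoin r x y"
  then obtain f g f' g' where
    *: "(f, g) \<in> poly_rel r" "(f', g') \<in> poly_rel r"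
      "a = poly f x" "b = poly g y" "a' = poly f' x" "b' = poly g' y"
    by (auto simp: adjoin_def)
  show "(a - a', b - b') \<in> adjoin r x y"
    using adjoinI[OF poly_rel_diff[OF r *(1,2)], of x y] by (simp add: *)
  show "(a * a', b * b') \<in> adjoin r x y"
    using adjoinI[OF poly_rel_mult[OF r *(1,2)], of x y] by (simp add: *)
qed

text \<open>Only the zero polynomial over the domain vanishes at \<open>x\<close>, so no condition
  on the image \<open>y\<close> arises.\<close>

lemma sends_zero_to_zero_adjoin_transcendental:
  assumes "sends_zero_to_zero r" "\<not> algebraic_over (Domain r) x"
  shows "sends_zero_to_zero (adjoin r x y)"
  unfolding sends_zero_to_zero_def
proof (intro allI impI)
  fix w assume "(0, w) \<in> adjoin r x y"
  then obtain f g where fg: "(f, g) \<in> poly_rel r" "poly f x = 0" "w = poly g y"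
    by (auto simp: adjoin_def)
  then have "f = 0"
    using assms(2) unfolding algebraic_over_def poly_rel_def by blast
  then show "w = 0"
    using poly_rel_zero[OF assms(1), of g] fg by simp
qed

text \<open>
  Here \<^verbatim>\<open>p\<close> plays the role of the minimal polynomial of \<^verbatim>\<open>x\<close>. As \<^verbatim>\<open>Domain r\<close> need not be a field,
  division by it is replaced by pseudo-division.
\<close>

lemma sends_zero_to_zero_adjoin_root:
  fixes x :: "'a::idom" and y :: "'b::idom"
  assumes r: "subring_rel r" "sends_zero_to_zero r"
    and p: "(p, p') \<in> poly_rel r" "p \<noteq> 0" "poly p x = 0" "poly p' y = 0"
      "coeff p' (degree p) \<noteq> 0"
    and minimal: "\<And>f g. \<lbrakk>(f, g) \<in> poly_rel r; f \<noteq> 0; poly f x = 0\<rbrakk> \<Longrightarrow> degree p \<le> degree f"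
  shows "sends_zero_to_zero (adjoin r x y)"
proof -
  have "poly g y = 0" if "(f, g) \<in> poly_rel r" "poly f x = 0" for f g
    using that
  proof (induction "degree f" arbitrary: f g rule: less_induct)
    case less
    show ?case
    proof (cases "f = 0")
      case True
      then show ?thesis using poly_rel_zero[OF r(2), of g] less.prems by simp
    next
      case False
      then have le: "degree p \<le> degree f"
        using minimal less.prems by blast
      define n where "n = degree f - degree p"
      \<comment> \<open>One step of pseudo-division cancels the leading term of \<open>f\<close>,
        and \<open>g1\<close> is the same combination of the partners. The partners' coefficients
        are read off at the degrees of \<open>p\<close> and \<open>f\<close>, since \<open>g\<close>
        may have smaller degree than \<open>f\<close>.\<close>
      define f1 where "f1 = smult (lead_coeff p) f - monom (lead_coeff f) n * p"
      define g1 where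
        "g1 = smult (coeff p' (degree p)) g - monom (coeff g (degree f)) n * p'"
      have rel: "(f1, g1) \<in> poly_rel r"
        unfolding f1_def g1_def
        using r(1) p(1) less.prems(1)
        by (intro poly_rel_diff poly_rel_mult poly_rel_smult poly_rel_monom poly_rel_coeff)
      have root: "poly f1 x = 0"
        using less.prems p by (simp add: f1_def)
      have "poly g1 y = 0"
      proof (cases "f1 = 0")
        case True
        then show ?thesis using poly_rel_zero[OF r(2), of g1] rel by simp
      next
        case nz: False
        have "degree f1 < degree f"
        \<comment> \<open>Cancelling the leading term lowers the degree only for nonconstant
          \<open>f\<close>. A constant \<open>f\<close> would force \<open>p\<close> to be a nonzero
          constant with a root.\<close>
        proof (cases "degree f = 0")
          case True
          then have "degree p = 0" using le by simp
          then have "poly p x = coeff p 0"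
            by (metis degree_eq_zeroE coeff_pCons_0 poly_const_conv poly_0 poly_pCons mult_zero_right add.right_neutral)
          then have False using p(2,3) \<open>degree p = 0\<close> by (metis leading_coeff_0_iff)
          then show ?thesis ..
        next
          case pos: False
          have d: "degree f1 \<le> degree f"
            unfolding f1_def using False p(2) le
            by (intro degree_diff_le) (simp_all add: degree_mult_eq degree_monom_eq n_def)
          have "coeff f1 (degree f) = 0"
            using le False p(2) coeff_monom_mult[of "lead_coeff f" n p "degree f"]
            by (simp add: f1_def n_def coeff_monom_mult)
          then show ?thesis
            using d nz by (metis le_neq_implies_less leading_coeff_0_iff)
        qed
        then show ?thesis using less.hyps rel root by blast
      qed
      \<comment> \<open>As \<open>p'\<close> vanishes at \<open>y\<close>, the value of
        \<open>g1\<close> there is that of \<open>g\<close> times the nonzero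
        \<open>coeff p' (degree p)\<close>.\<close>
      then show ?thesis using p(4,5) by (simp add: g1_def)
    qed
  qed
  then show ?thesis
    unfolding sends_zero_to_zero_def adjoin_def by fastforce
qed

text \<open>Suppose a nonzero \<open>x\<close> is sent to 0, and let \<open>f\<close> over the
  domain of \<open>r\<^sub>0\<close> vanish at \<open>x\<close>. Its constant term is then sent to
  0, so it is 0 by injectivity of \<open>r\<^sub>0\<close>, and dividing \<open>f\<close> by the
  variable gives an infinite descent in the degree.\<close>

lemma sends_zero_to_zero_converse_of_algebraic:
  fixes r :: "('a::idom \<times> 'b::idom) set"
  assumes r: "subring_rel r" "sends_zero_to_zero r" "r\<^sub>0 \<subseteq> r" "sends_zero_to_zero (r\<^sub>0\<inverse>)"
    "subring_rel r\<^sub>0"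
    and alg: "\<And>x. x \<in> Domain r \<Longrightarrow> algebraic_over (Domain r\<^sub>0) x"
  shows "sends_zero_to_zero (r\<inverse>)"
  unfolding sends_zero_to_zero_def
proof (intro allI impI)
  fix x assume "(0, x) \<in> r\<inverse>"
  then have x0: "(x, 0) \<in> r" by simp
  show "x = 0"
  proof (rule ccontr)
    assume "x \<noteq> 0"
    obtain f where f: "f \<noteq> 0" "\<And>i. coeff f i \<in> Domain r\<^sub>0" "poly f x = 0"
      using alg[of x] x0 unfolding algebraic_over_def by blast
    have "False" if "f \<noteq> 0" "\<And>i. coeff f i \<in> Domain r\<^sub>0" "poly f x = 0" for f
      using that
    proof (induction "degree f" arbitrary: f rule: less_induct)
      case less
      obtain g where g: "(f, g) \<in> poly_rel r\<^sub>0"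
        using poly_rel_exists[OF r(5)] less.prems(2) by blast
      have "(f, g) \<in> poly_rel r"
        using g r(3) by (auto simp: poly_rel_def)
      have "(poly f x, coeff g 0) \<in> r"
      proof -
        have pw: "(x ^ i, 0 ^ i) \<in> r" for i
        proof (induction i)
          case (Suc i)
          then show ?case using subring_rel_mult[OF r(1) x0] by simp
        qed (simp add: subring_rel_one[OF r(1)])
        \<comment> \<open>Both sums run up to \<open>degree f\<close> to keep the terms paired; on
          the right only the constant term survives.\<close>
        have "(poly f x, \<Sum>i\<le>degree f. coeff g i * 0 ^ i) \<in> r"
          unfolding poly_altdef
          using \<open>(f, g) \<in> poly_rel r\<close> pw
          by (intro subring_rel_sum[OF r(1)] subring_rel_mult[OF r(1)] poly_rel_coeff)
        then show ?thesis
          by (simp add: power_0_left if_distrib cong: if_cong)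
      qed
      then have "coeff g 0 = 0"
        using r(2) less.prems(3) by (simp add: sends_zero_to_zero_def)
      then have f0: "coeff f 0 = 0"
        using poly_rel_coeff[OF g, of 0] r(4) by (auto simp: sends_zero_to_zero_def)
      then obtain f' where f': "f = pCons 0 f'"
        by (metis pCons_cases coeff_pCons_0)
      have "coeff f' i \<in> Domain r\<^sub>0" for i
        using less.prems(2)[of "Suc i"] f' by simp
      moreover have "f' \<noteq> 0" "poly f' x = 0"
        using less.prems f' \<open>x \<noteq> 0\<close> by auto
      moreover have "degree f' < degree f"
        using f' \<open>f' \<noteq> 0\<close> by simp
      ultimately show False using less.hyps by blast
    qed
    with f show False by blast
  qed
qed

section \<open>Maximal extensions of partial homomorphisms\<close>

lemma exists_transcendental_extension:
  fixes r\<^sub>0 :: "('a::idom \<times> 'a) set"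
  assumes "subring_rel r\<^sub>0" "sends_zero_to_zero r\<^sub>0" "sends_zero_to_zero (r\<^sub>0\<inverse>)"
    "Range r\<^sub>0 = Domain r\<^sub>0"
  shows "\<exists>r. r\<^sub>0 \<subseteq> r \<and> subring_rel r \<and> sends_zero_to_zero r \<and> sends_zero_to_zero (r\<inverse>) \<and>
    Range r = Domain r \<and> (\<forall>x. algebraic_over (Domain r) x)"
proof -
  define \<A> where "\<A> = {r. r\<^sub>0 \<subseteq> r \<and> subring_rel r \<and> sends_zero_to_zero r \<and>
    sends_zero_to_zero (r\<inverse>) \<and> Range r = Domain r}"
  have "\<exists>r\<in>\<A>. \<forall>s\<in>\<A>. r \<subseteq> s \<longrightarrow> s = r"
  proof (rule subset_Zorn_nonempty)
    show "\<A> \<noteq> {}" using assms unfolding \<A>_def by blast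
  next
    fix \<C> assume \<C>: "\<C> \<noteq> {}" "subset.chain \<A> \<C>"
    then have sub: "\<C> \<subseteq> \<A>" and ch: "\<And>r s. \<lbrakk>r \<in> \<C>; s \<in> \<C>\<rbrakk> \<Longrightarrow> r \<subseteq> s \<or> s \<subseteq> r"
      by (auto simp: subset_chain_def)
    have "subring_rel (\<Union>\<C>)"
      using \<C>(1) ch sub by (intro subring_rel_Union_chain) (auto simp: \<A>_def)
    moreover have "r\<^sub>0 \<subseteq> \<Union>\<C>"
      using \<C>(1) sub unfolding \<A>_def by blast
    moreover have "sends_zero_to_zero (\<Union>\<C>)" "sends_zero_to_zero ((\<Union>\<C>)\<inverse>)"
      using sub unfolding \<A>_def sends_zero_to_zero_def by auto
    moreover have "Range (\<Union>\<C>) = Domain (\<Union>\<C>)"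
      using sub unfolding \<A>_def by (simp add: Range_Union Domain_Union subset_iff)
    ultimately show "\<Union>\<C> \<in> \<A>" unfolding \<A>_def by blast
  qed
  then obtain r where r: "r \<in> \<A>" and max: "\<And>s. \<lbrakk>s \<in> \<A>; r \<subseteq> s\<rbrakk> \<Longrightarrow> s = r"
    by blast
  have R: "r\<^sub>0 \<subseteq> r" "subring_rel r" "sends_zero_to_zero r" "sends_zero_to_zero (r\<inverse>)"
    "Range r = Domain r"
    using r unfolding \<A>_def by auto
  have "algebraic_over (Domain r) x" for x
  proof (rule ccontr)
    assume trans: "\<not> algebraic_over (Domain r) x"
    let ?s = "adjoin r x x"
    have "sends_zero_to_zero ?s"
      by (rule sends_zero_to_zero_adjoin_transcendental[OF R(3) trans])
    moreover have "sends_zero_to_zero (?s\<inverse>)"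
      unfolding adjoin_converse[symmetric]
      by (rule sends_zero_to_zero_adjoin_transcendental[OF R(4)]) (simp add: R(5) trans)
    moreover have "Range ?s = Domain ?s"
      using Domain_adjoin[OF R(2), of x x] Domain_adjoin[of "r\<inverse>" x x] R(2,5)
      by (simp add: adjoin_converse subring_rel_converse)
    moreover have "r \<subseteq> ?s" "subring_rel ?s"
      using subset_adjoin subring_rel_adjoin R(2) by blast+
    moreover have "r\<^sub>0 \<subseteq> ?s"
      using R(1) \<open>r \<subseteq> ?s\<close> by (rule subset_trans)
    ultimately have "?s = r"
      by (intro max) (simp_all add: \<A>_def)
    then have "x \<in> Domain r"
      using in_adjoin[OF R(2)] by blast
    then have "algebraic_over (Domain r) x"
    proof -
      have "(-x) \<in> Domain r" "1 \<in> Domain r" "0 \<in> Domain r"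
        using \<open>x \<in> Domain r\<close> subring_rel_diff[OF R(2) subring_rel_zero[OF R(2)]]
          subring_rel_one[OF R(2)] subring_rel_zero[OF R(2)] by force+
      then show ?thesis
        unfolding algebraic_over_def
        by (intro exI[of _ "[:-x, 1:]"]) (auto simp: coeff_pCons split: nat.split)
    qed
    with trans show False ..
  qed
  then show ?thesis using R by blast
qed

text \<open>Zorn's lemma is applied to single-valued extensions only; injectivity then follows from
  algebraicity over the domain of \<open>r\<^sub>0\<close>. At a maximal relation every
  \<open>x\<close> already has an image, because it could be sent to a root of the image of its
  polynomial of least degree.\<close>

lemma exists_algebraic_extension:
  fixes r\<^sub>0 :: "('a::idom \<times> 'b::alg_closed_field) set"
  assumes r\<^sub>0: "subring_rel r\<^sub>0" "sends_zero_to_zero r\<^sub>0" "sends_zero_to_zero (r\<^sub>0\<inverse>)"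
    and alg: "\<And>x. algebraic_over (Domain r\<^sub>0) x"
  shows "\<exists>r. r\<^sub>0 \<subseteq> r \<and> subring_rel r \<and> sends_zero_to_zero r \<and> sends_zero_to_zero (r\<inverse>) \<and>
    Domain r = UNIV"
proof -
  define \<A> where "\<A> = {r. r\<^sub>0 \<subseteq> r \<and> subring_rel r \<and> sends_zero_to_zero r}"
  have "\<exists>r\<in>\<A>. \<forall>s\<in>\<A>. r \<subseteq> s \<longrightarrow> s = r"
  proof (rule subset_Zorn_nonempty)
    show "\<A> \<noteq> {}" using assms unfolding \<A>_def by blast
  next
    fix \<C> assume \<C>: "\<C> \<noteq> {}" "subset.chain \<A> \<C>"
    then have sub: "\<C> \<subseteq> \<A>" and ch: "\<And>r s. \<lbrakk>r \<in> \<C>; s \<in> \<C>\<rbrakk> \<Longrightarrow> r \<subseteq> s \<or> s \<subseteq> r"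
      by (auto simp: subset_chain_def)
    have "subring_rel (\<Union>\<C>)"
      using \<C>(1) ch sub by (intro subring_rel_Union_chain) (auto simp: \<A>_def)
    moreover have "r\<^sub>0 \<subseteq> \<Union>\<C>"
      using \<C>(1) sub unfolding \<A>_def by blast
    moreover have "sends_zero_to_zero (\<Union>\<C>)"
      using sub unfolding \<A>_def sends_zero_to_zero_def by auto
    ultimately show "\<Union>\<C> \<in> \<A>" unfolding \<A>_def by blast
  qed
  then obtain r where r: "r \<in> \<A>" and max: "\<And>s. \<lbrakk>s \<in> \<A>; r \<subseteq> s\<rbrakk> \<Longrightarrow> s = r"
    by blast
  have R: "r\<^sub>0 \<subseteq> r" "subring_rel r" "sends_zero_to_zero r"
    using r unfolding \<A>_def by auto
  have inj: "sends_zero_to_zero (r\<inverse>)"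
    using sends_zero_to_zero_converse_of_algebraic[OF R(2,3,1) r\<^sub>0(3,1)] alg by blast
  have "x \<in> Domain r" for x
  proof -
    obtain f where f: "f \<noteq> 0" "\<And>i. coeff f i \<in> Domain r\<^sub>0" "poly f x = 0"
      using alg unfolding algebraic_over_def by blast
    have "\<exists>p. (p \<noteq> 0 \<and> (\<forall>i. coeff p i \<in> Domain r) \<and> poly p x = 0) \<and>
        (\<forall>h. h \<noteq> 0 \<and> (\<forall>i. coeff h i \<in> Domain r) \<and> poly h x = 0 \<longrightarrow> degree p \<le> degree h)"
      by (rule ex_has_least_nat[of _ f]) (use f R(1) in blast)
    then obtain p where p: "p \<noteq> 0" "\<And>i. coeff p i \<in> Domain r" "poly p x = 0"
      and minimal: "\<And>h. \<lbrakk>h \<noteq> 0; \<And>i. coeff h i \<in> Domain r; poly h x = 0\<rbrakk> \<Longrightarrow> degree p \<le> degree h"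
      by blast
    obtain p' where p': "(p, p') \<in> poly_rel r"
      using poly_rel_exists[OF R(2)] p(2) by blast
    \<comment> \<open>Injectivity keeps the leading coefficient of \<open>p\<close> from being sent
      to 0, so \<open>p'\<close> is not constant and has a root.\<close>
    have lc: "coeff p' (degree p) \<noteq> 0"
      using poly_rel_coeff[OF p', of "degree p"] inj p(1)
      by (auto simp: sends_zero_to_zero_def)
    have "degree p > 0"
      using p(1,3) by (metis degree_eq_zeroE gr0I poly_const_conv pCons_0_0)
    then have "degree p' > 0"
      using lc by (metis le_degree less_le_trans)
    then obtain y where y: "poly p' y = 0"
      using alg_closed_imp_poly_has_root by blast
    have "sends_zero_to_zero (adjoin r x y)"
    proof (rule sends_zero_to_zero_adjoin_root[OF R(2,3) p' p(1,3) y lc])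
      fix f g assume "(f, g) \<in> poly_rel r" "f \<noteq> 0" "poly f x = 0"
      then show "degree p \<le> degree f"
        using minimal poly_rel_coeff by blast
    qed
    then have "adjoin r x y = r"
      using subring_rel_adjoin[OF R(2)] subset_adjoin[OF R(2)] R(1)
      by (intro max) (simp_all add: \<A>_def subset_trans[OF R(1)])
    then show ?thesis
      using in_adjoin[OF R(2), of x y] by blast
  qed
  then show ?thesis using R inj by blast
qed

section \<open>Surjectivity and the extension theorem\<close>

definition ring_endomorphism :: "('a::ring_1 \<Rightarrow> 'a) \<Rightarrow> bool" where
  "ring_endomorphism \<sigma> \<longleftrightarrow> \<sigma> 1 = 1 \<and> (\<forall>x y. \<sigma> (x + y) = \<sigma> x + \<sigma> y) \<and> (\<forall>x y. \<sigma> (x * y) = \<sigma> x * \<sigma> y)"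

text \<open>A polynomial over the range of \<open>\<sigma>\<close> is the image of some
  \<open>p\<close>. Since \<open>p\<close> splits into linear factors, so does its image, whose
  roots are therefore values of \<open>\<sigma>\<close>. The induction removes one factor at a
  time.\<close>

lemma surj_of_algebraic:
  fixes \<sigma> :: "'a::alg_closed_field \<Rightarrow> 'a"
  assumes \<sigma>: "ring_endomorphism \<sigma>" and alg: "\<And>x. algebraic_over (range \<sigma>) x"
  shows "surj \<sigma>"
proof -
  have add: "\<sigma> (x + y) = \<sigma> x + \<sigma> y" and mult: "\<sigma> (x * y) = \<sigma> x * \<sigma> y" and one: "\<sigma> 1 = 1" for x y
    using \<sigma> by (auto simp: ring_endomorphism_def)
  have zero: "\<sigma> 0 = 0" using add[of 0 0] by (simp only: add_0_right add_cancel_right_right)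
  have minus: "\<sigma> (- x) = - \<sigma> x" for x
    using add[of x "- x"] zero by (simp add: eq_neg_iff_add_eq_0 add.commute)
  have diff: "\<sigma> (x - y) = \<sigma> x - \<sigma> y" for x y
    using add[of x "- y"] minus by simp
  have nz: "\<sigma> x \<noteq> 0" if "x \<noteq> 0" for x
    using mult[of x "inverse x"] that one by auto
  have "z \<in> range \<sigma>" if "p \<noteq> 0" "poly (map_poly \<sigma> p) z = 0" for p z
    using that
  proof (induction "degree p" arbitrary: p rule: less_induct)
    case less
    show ?case
    proof (cases "degree p = 0")
      case True
      then obtain c where "p = [:c:]" by (rule degree_eq_zeroE)
      then show ?thesis using less.prems nz by (simp add: map_poly_pCons zero)
    next
      case False
      then obtain a where "poly p a = 0"
        using alg_closed_imp_poly_has_root by blast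
      then obtain h where h: "p = [:- a, 1:] * h"
        using poly_eq_0_iff_dvd by (metis dvdE)
      \<comment> \<open>Coefficientwise, the image of \<open>p\<close> is the image of
        \<open>h\<close> times the linear factor with root \<open>\<sigma> a\<close>.\<close>
      have eq: "map_poly \<sigma> p = pCons 0 (map_poly \<sigma> h) - smult (\<sigma> a) (map_poly \<sigma> h)"
        by (rule poly_eqI)
          (simp add: h coeff_map_poly zero coeff_pCons diff mult minus split: nat.split)
      then have "(z - \<sigma> a) * poly (map_poly \<sigma> h) z = 0"
        using less.prems(2) unfolding eq by (simp add: algebra_simps)
      moreover have "h \<noteq> 0" "degree h < degree p"
        using h less.prems(1) by (auto simp: degree_mult_eq simp del: mult_pCons_left)
      ultimately show ?thesis using less.hyps by auto
    qed
  qed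
  moreover have "\<exists>p. p \<noteq> 0 \<and> poly (map_poly \<sigma> p) z = 0" for z
  proof -
    obtain f where f: "f \<noteq> 0" "\<And>i. coeff f i \<in> range \<sigma>" "poly f z = 0"
      using alg unfolding algebraic_over_def by blast
    \<comment> \<open>Each coefficient is pulled back along \<open>\<sigma>\<close>. The case split
      makes the chosen function send 0 to 0 by definition, as \<open>coeff_map_poly\<close>
      requires.\<close>
    define p where "p = map_poly (\<lambda>y. if y = 0 then 0 else SOME x. \<sigma> x = y) f"
    have map: "map_poly \<sigma> p = f"
    proof (rule poly_eqI)
      fix i
      have "\<sigma> (SOME x. \<sigma> x = coeff f i) = coeff f i"
        by (rule someI_ex) (metis f(2) rangeE)
      then show "coeff (map_poly \<sigma> p) i = coeff f i"
        by (simp add: p_def coeff_map_poly zero)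
    qed
    moreover have "p \<noteq> 0" using map f(1) by auto
    ultimately show ?thesis using f(3) by blast
  qed
  ultimately show ?thesis by blast
qed

theorem automorphism_extension:
  fixes q :: "'a::alg_closed_field \<Rightarrow> 'a"
  assumes L: "1 \<in> L" "\<And>x y. \<lbrakk>x \<in> L; y \<in> L\<rbrakk> \<Longrightarrow> x - y \<in> L" "\<And>x y. \<lbrakk>x \<in> L; y \<in> L\<rbrakk> \<Longrightarrow> x * y \<in> L"
    and q: "q 1 = 1" "\<And>x y. \<lbrakk>x \<in> L; y \<in> L\<rbrakk> \<Longrightarrow> q (x - y) = q x - q y"
      "\<And>x y. \<lbrakk>x \<in> L; y \<in> L\<rbrakk> \<Longrightarrow> q (x * y) = q x * q y" "bij_betw q L L"
  shows "\<exists>\<sigma>. ring_endomorphism \<sigma> \<and> bij \<sigma> \<and> (\<forall>x\<in>L. \<sigma> x = q x)"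
proof -
  define r\<^sub>0 where "r\<^sub>0 = (\<lambda>x. (x, q x)) ` L"
  have "subring_rel r\<^sub>0"
    using L q by (auto simp: subring_rel_def r\<^sub>0_def image_iff)
  moreover have "0 \<in> L" "q 0 = 0"
    using L(1) L(2)[of 1 1] q(2)[of 1 1] by auto
  then have "sends_zero_to_zero r\<^sub>0" "sends_zero_to_zero (r\<^sub>0\<inverse>)"
    using q(4) by (auto simp: sends_zero_to_zero_def r\<^sub>0_def bij_betw_def inj_on_def)
  \<comment> \<open>Bijectivity of \<open>q\<close> on \<open>L\<close> gives the equality of domain
    and range with which the transcendental extension starts.\<close>
  moreover have "Domain r\<^sub>0 = L" "Range r\<^sub>0 = L"
    using q(4) by (simp_all add: r\<^sub>0_def bij_betw_def Domain_fst Range_snd image_image)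
  ultimately obtain r\<^sub>1 where r\<^sub>1: "r\<^sub>0 \<subseteq> r\<^sub>1" "subring_rel r\<^sub>1" "sends_zero_to_zero r\<^sub>1"
      "sends_zero_to_zero (r\<^sub>1\<inverse>)" "Range r\<^sub>1 = Domain r\<^sub>1" "\<And>x. algebraic_over (Domain r\<^sub>1) x"
    using exists_transcendental_extension[of r\<^sub>0] by auto
  obtain r where r: "r\<^sub>1 \<subseteq> r" "subring_rel r" "sends_zero_to_zero r" "sends_zero_to_zero (r\<inverse>)"
      "Domain r = UNIV"
    using exists_algebraic_extension[OF r\<^sub>1(2-4,6)] by blast
  define \<sigma> where "\<sigma> x = (SOME y. (x, y) \<in> r)" for x
  have in_r: "(x, \<sigma> x) \<in> r" for x
    unfolding \<sigma>_def by (rule someI_ex) (use r(5) in blast)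
  have eq: "\<sigma> x = y" if "(x, y) \<in> r" for x y
    using sends_zero_to_zeroD[OF r(2,3) in_r that] .
  have endo: "ring_endomorphism \<sigma>"
    unfolding ring_endomorphism_def
    by (intro conjI allI eq subring_rel_one subring_rel_add subring_rel_mult in_r r(2))
  have "inj \<sigma>"
    using sends_zero_to_zeroD[OF _ r(4)] in_r r(2) subring_rel_converse
    by (metis converseI injI)
  \<comment> \<open>The domain of \<open>r\<^sub>1\<close> equals its range, which consists of
    values of \<open>\<sigma>\<close>; hence every element is algebraic over the range of
    \<open>\<sigma>\<close>.\<close>
  moreover have "Domain r\<^sub>1 \<subseteq> range \<sigma>"
    using r\<^sub>1(5) r(1) eq by (metis Range.cases rangeI subsetD subsetI)
  then have "surj \<sigma>"
    using r\<^sub>1(6) by (intro surj_of_algebraic[OF endo]) (meson algebraic_over_def subsetD)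
  moreover have "\<forall>x\<in>L. \<sigma> x = q x"
    using r\<^sub>1(1) r(1) eq by (auto simp: r\<^sub>0_def)
  ultimately show ?thesis using endo by (auto simp: bij_def)
qed

section \<open>Galois twists of linear categories\<close>

text \<open>The inverse makes structure constants transform by \<^verbatim>\<open>\<sigma>\<close> itself.\<close>

definition galois_twist ::
  "(complex \<Rightarrow> complex) \<Rightarrow> ('o, 'm, 'x) linear_cat_scheme \<Rightarrow> ('o, 'm, 'x) linear_cat_scheme" where
  "galois_twist \<sigma> C = C\<lparr>scal := (\<lambda>t. scal C (the_inv \<sigma> t))\<rparr>"

lemma galois_twist_linear [simp]:
  "Ob (galois_twist \<sigma> C) = Ob C" "Hom (galois_twist \<sigma> C) = Hom C" "idt (galois_twist \<sigma> C) = idt C"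
  "cmp (galois_twist \<sigma> C) = cmp C" "scal (galois_twist \<sigma> C) t = scal C (the_inv \<sigma> t)"
  by (simp_all add: galois_twist_def)

lemma galois_twist_monoidal [simp]:
  "tob (galois_twist \<sigma> C) = tob C" "tar (galois_twist \<sigma> C) = tar C"
  "unit_ob (galois_twist \<sigma> C) = unit_ob C" "asc (galois_twist \<sigma> C) = asc C"
  "lun (galois_twist \<sigma> C) = lun C" "run (galois_twist \<sigma> C) = run C"
  by (simp_all add: galois_twist_def)

lemma galois_twist_pivotal [simp]:
  "dual (galois_twist \<sigma> C) = dual C" "lev (galois_twist \<sigma> C) = lev C"
  "lcoev (galois_twist \<sigma> C) = lcoev C" "rev (galois_twist \<sigma> C) = rev C"
  "rcoev (galois_twist \<sigma> C) = rcoev C"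
  by (simp_all add: galois_twist_def)

lemma galois_twist_braid [simp]: "braid (galois_twist \<sigma> C) = braid C"
  by (simp add: galois_twist_def)

lemma galois_twist_gcrossed [simp]:
  "deg (galois_twist \<sigma> D) = deg D" "acto (galois_twist \<sigma> D) = acto D"
  "actm (galois_twist \<sigma> D) = actm D" "act_ten (galois_twist \<sigma> D) = act_ten D"
  "act_unit (galois_twist \<sigma> D) = act_unit D" "act_comp (galois_twist \<sigma> D) = act_comp D"
  "act_one (galois_twist \<sigma> D) = act_one D" "gbraid (galois_twist \<sigma> D) = gbraid D"
  by (simp_all add: galois_twist_def)

text \<open>\<open>direct_sum\<close> adds arrows, so it is stated for a separate \<open>C'\<close>
  and the other equations do not inherit its sort constraint.\<close>

lemma galois_twist_scal_free [simp]:
  "iso_in (galois_twist \<sigma> C) = iso_in C" "inv_in (galois_twist \<sigma> C) = inv_in C"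
  "isomorphic_in (galois_twist \<sigma> C) = isomorphic_in C"
  "direct_sum (galois_twist \<sigma> C') = direct_sum C'"
  by (simp_all add: fun_eq_iff iso_in_def inv_in_def isomorphic_in_def direct_sum_def)

lemma galois_twist_asc_inv [simp]: "asc_inv (galois_twist \<sigma> C) = asc_inv C"
  by (simp add: fun_eq_iff asc_inv_def)

lemma galois_twist_nested [simp]:
  "nested_lev (galois_twist \<sigma> C) = nested_lev C" "nested_rev (galois_twist \<sigma> C) = nested_rev C"
  by (simp_all add: fun_eq_iff nested_lev_def nested_rev_def)

lemma trivial_component_galois_twist:
  "trivial_component G (galois_twist \<sigma> D) = galois_twist \<sigma> (trivial_component G D)"
  by (simp add: trivial_component_def galois_twist_def)

text \<open>Equivariant objects, maps, tensor products, duals and braidings are defined without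
  scalars, so only the field \<open>scal\<close> changes.\<close>

lemma equivariantization_galois_twist:
  "equivariantization G (galois_twist \<sigma> D) = galois_twist \<sigma> (equivariantization G D)"
proof -
  have "equivariant_objects G (galois_twist \<sigma> D) = equivariant_objects G D"
    by (simp add: equivariant_objects_def)
  moreover have "equivariant_maps G (galois_twist \<sigma> D) = equivariant_maps G D"
    by (simp add: fun_eq_iff equivariant_maps_def)
  moreover have "equivariant_tensor G (galois_twist \<sigma> D) = equivariant_tensor G D"
    by (simp add: fun_eq_iff equivariant_tensor_def)
  moreover have "equivariant_dual G (galois_twist \<sigma> D) = equivariant_dual G D"
    by (simp add: fun_eq_iff equivariant_dual_def)
  moreover have "equivariant_braid G (galois_twist \<sigma> D) = equivariant_braid G D"
    by (simp add: fun_eq_iff equivariant_braid_def)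
  moreover have "scal (galois_twist \<sigma> D) = (\<lambda>t. scal D (the_inv \<sigma> t))"
    by (simp add: galois_twist_def)
  ultimately show ?thesis
    unfolding equivariantization_def by (simp add: galois_twist_def)
qed

section \<open>Automorphisms of the complex field and twisted vector spaces\<close>

locale complex_automorphism =
  fixes \<sigma> :: "complex \<Rightarrow> complex"
  assumes endomorphism: "ring_endomorphism \<sigma>" and bij: "bij \<sigma>"
begin

lemma hom_one [simp]: "\<sigma> 1 = 1"
  and hom_add: "\<sigma> (x + y) = \<sigma> x + \<sigma> y"
  and hom_mult: "\<sigma> (x * y) = \<sigma> x * \<sigma> y"
  using endomorphism by (auto simp: ring_endomorphism_def)

lemma inv_hom [simp]: "the_inv \<sigma> (\<sigma> x) = x"
  using bij by (simp add: bij_is_inj the_inv_f_f)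

lemma hom_inv [simp]: "\<sigma> (the_inv \<sigma> x) = x"
  using bij by (simp add: bij_def f_the_inv_into_f)

lemma inv_one [simp]: "the_inv \<sigma> 1 = 1"
  by (metis hom_one inv_hom)

lemma inv_add: "the_inv \<sigma> (x + y) = the_inv \<sigma> x + the_inv \<sigma> y"
  by (metis hom_add hom_inv inv_hom)

lemma inv_mult: "the_inv \<sigma> (x * y) = the_inv \<sigma> x * the_inv \<sigma> y"
  by (metis hom_mult hom_inv inv_hom)

lemma hom_zero [simp]: "\<sigma> 0 = 0"
  using hom_add[of 0 0] by (simp only: add_0_right add_cancel_right_right)

lemma hom_eq_0_iff [simp]: "\<sigma> x = 0 \<longleftrightarrow> x = 0"
  by (metis hom_zero inv_hom)

lemma inv_eq_0_iff [simp]: "the_inv \<sigma> x = 0 \<longleftrightarrow> x = 0"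
  by (metis hom_eq_0_iff hom_inv)

lemma hom_uminus: "\<sigma> (- x) = - \<sigma> x"
  using hom_add[of x "- x"] by (simp add: eq_neg_iff_add_eq_0 add.commute)

lemma hom_diff: "\<sigma> (x - y) = \<sigma> x - \<sigma> y"
  using hom_add[of x "- y"] by (simp add: hom_uminus)

lemma hom_of_nat: "\<sigma> (of_nat n) = of_nat n"
  by (induction n) (simp_all add: hom_add)

lemma hom_of_int: "\<sigma> (of_int n) = of_int n"
  by (cases n) (simp_all add: hom_of_nat hom_uminus hom_diff)

lemma hom_sum: "\<sigma> (sum f A) = (\<Sum>x\<in>A. \<sigma> (f x))"
  by (induction A rule: infinite_finite_induct) (simp_all add: hom_add)

text \<open>The inverse of \<open>\<sigma>\<close> is onto, so reindexing by it leaves the set of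
  multiples of an identity arrow, and with it simplicity, unchanged.\<close>

lemma range_inv: "range (\<lambda>t. h (the_inv \<sigma> t)) = range h"
proof -
  have "range (the_inv \<sigma>) = UNIV"
    by (rule surjI[of _ \<sigma>]) (rule inv_hom)
  then show ?thesis
    by (simp add: image_image[of h "the_inv \<sigma>" UNIV, symmetric])
qed

lemma vector_space_twist:
  "vector_space s \<Longrightarrow> vector_space (\<lambda>t. s (the_inv \<sigma> t))"
  by (simp add: vector_space_def inv_add inv_mult)

text \<open>Closure under all scalars does not depend on how they are indexed. Spans and linear
  dependence inherit this invariance.\<close>

lemma subspace_twist:
  assumes "vector_space s"
  shows "module.subspace (\<lambda>t. s (the_inv \<sigma> t)) V \<longleftrightarrow> module.subspace s V"
proof -
  interpret V: vector_space s by fact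
  interpret W: vector_space "\<lambda>t. s (the_inv \<sigma> t)" by (rule vector_space_twist) fact
  show ?thesis
    unfolding V.subspace_def W.subspace_def by (metis inv_hom)
qed

lemma span_twist:
  assumes "vector_space s"
  shows "module.span (\<lambda>t. s (the_inv \<sigma> t)) B = module.span s B"
proof -
  interpret V: vector_space s by fact
  interpret W: vector_space "\<lambda>t. s (the_inv \<sigma> t)" by (rule vector_space_twist) fact
  show ?thesis
    unfolding V.span_def W.span_def subspace_twist[OF assms] ..
qed

lemma dependent_twist:
  assumes "vector_space s"
  shows "module.dependent (\<lambda>t. s (the_inv \<sigma> t)) B \<longleftrightarrow> module.dependent s B"
proof -
  interpret V: vector_space s by fact
  interpret W: vector_space "\<lambda>t. s (the_inv \<sigma> t)" by (rule vector_space_twist) fact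
  show ?thesis
    unfolding V.dependent_def W.dependent_def span_twist[OF assms] ..
qed

section \<open>Invariance of the categorical axioms under twisting\<close>

lemma scal_galois_twist: "scal (galois_twist \<sigma> C) = (\<lambda>t. scal C (the_inv \<sigma> t))"
  by (simp add: fun_eq_iff)

lemma simple_object_galois_twist [simp]:
  "simple_object (galois_twist \<sigma> C) x \<longleftrightarrow> simple_object C x"
  using range_inv[of "\<lambda>t. scal C t (idt C x)"] by (simp add: simple_object_def)

lemma simple_representatives_galois_twist [simp]:
  "simple_representatives (galois_twist \<sigma> C) I \<longleftrightarrow> simple_representatives C I"
  by (simp add: simple_representatives_def)

text \<open>Compatibility of composition with a scalar \<open>t\<close> is the old axiom at
  \<open>the_inv \<sigma> t\<close>; the axioms free of scalars are literally unchanged. The richer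
  structures below follow the same pattern.\<close>

lemma linear_category_galois_twist:
  assumes "linear_category C"
  shows "linear_category (galois_twist \<sigma> C)"
proof -
  interpret linear_category C by fact
  show ?thesis
    unfolding linear_category_def scal_galois_twist galois_twist_linear
      subspace_twist[OF arrows_vector_space]
    using vector_space_twist[OF arrows_vector_space] assms[unfolded linear_category_def]
    by (elim conjE, intro conjI)
      (assumption | (intro allI impI, rule cmp_scal_right cmp_scal_left; assumption))+
qed

lemma monoidal_linear_category_galois_twist:
  assumes "monoidal_linear_category C"
  shows "monoidal_linear_category (galois_twist \<sigma> C)"
proof (intro monoidal_linear_category.intro linear_category_galois_twist)
  show "linear_category C"
    using assms by (rule monoidal_linear_category.axioms)
  interpret monoidal_linear_category C by fact
  show "monoidal_linear_category_axioms (galois_twist \<sigma> C)"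
    using monoidal_linear_category.axioms(2)[OF assms]
    unfolding monoidal_linear_category_axioms_def galois_twist_linear galois_twist_monoidal
      galois_twist_scal_free
    by (elim conjE, intro conjI)
      (assumption | (intro allI impI, rule tar_scal_left tar_scal_right; assumption))+
qed

lemma pivotal_linear_category_galois_twist:
  assumes "pivotal_linear_category C"
  shows "pivotal_linear_category (galois_twist \<sigma> C)"
proof (intro pivotal_linear_category.intro monoidal_linear_category_galois_twist)
  show "monoidal_linear_category C"
    using assms by (rule pivotal_linear_category.axioms)
  show "pivotal_linear_category_axioms (galois_twist \<sigma> C)"
    using pivotal_linear_category.axioms(2)[OF assms]
    unfolding pivotal_linear_category_axioms_def galois_twist_linear galois_twist_monoidal
      galois_twist_pivotal galois_twist_nested galois_twist_asc_inv .
qed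

lemma spherical_fusion_category_galois_twist:
  assumes "spherical_fusion_category C"
  shows "spherical_fusion_category (galois_twist \<sigma> C)"
proof (intro spherical_fusion_category.intro pivotal_linear_category_galois_twist)
  show "pivotal_linear_category C"
    using assms by (rule spherical_fusion_category.axioms)
  show "spherical_fusion_category_axioms (galois_twist \<sigma> C)"
    using spherical_fusion_category.axioms(2)[OF assms]
    unfolding spherical_fusion_category_axioms_def galois_twist_linear galois_twist_monoidal
      galois_twist_pivotal galois_twist_scal_free simple_object_galois_twist
      simple_representatives_galois_twist .
qed

lemma braided_spherical_fusion_category_galois_twist:
  assumes "braided_spherical_fusion_category C"
  shows "braided_spherical_fusion_category (galois_twist \<sigma> C)"
proof (intro braided_spherical_fusion_category.intro spherical_fusion_category_galois_twist)
  show "spherical_fusion_category C"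
    using assms by (rule braided_spherical_fusion_category.axioms)
  show "braided_spherical_fusion_category_axioms (galois_twist \<sigma> C)"
    using braided_spherical_fusion_category.axioms(2)[OF assms]
    unfolding braided_spherical_fusion_category_axioms_def galois_twist_linear
      galois_twist_monoidal galois_twist_scal_free galois_twist_asc_inv galois_twist_braid .
qed

lemma faithfully_graded_category_galois_twist:
  assumes "faithfully_graded_category G D"
  shows "faithfully_graded_category G (galois_twist \<sigma> D)"
proof (intro faithfully_graded_category.intro spherical_fusion_category_galois_twist)
  show "spherical_fusion_category D"
    using assms by (rule faithfully_graded_category.axioms)
  show "faithfully_graded_category_axioms G (galois_twist \<sigma> D)"
    using faithfully_graded_category.axioms(2)[OF assms]
    unfolding faithfully_graded_category_axioms_def galois_twist_linear
      galois_twist_monoidal galois_twist_scal_free galois_twist_gcrossed .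
qed

lemma action_on_category_galois_twist:
  assumes "action_on_category G D"
  shows "action_on_category G (galois_twist \<sigma> D)"
proof (intro action_on_category.intro spherical_fusion_category_galois_twist)
  show "spherical_fusion_category D"
    using assms by (rule action_on_category.axioms)
  interpret action_on_category G D by fact
  show "action_on_category_axioms G (galois_twist \<sigma> D)"
    using action_on_category.axioms(2)[OF assms]
    unfolding action_on_category_axioms_def galois_twist_linear galois_twist_monoidal
      galois_twist_pivotal galois_twist_scal_free galois_twist_gcrossed
    by (elim conjE, intro conjI)
      (assumption | (intro allI impI, rule actm_scal; assumption))+
qed

lemma gcrossed_braided_category_galois_twist:
  assumes "gcrossed_braided_category G D"
  shows "gcrossed_braided_category G (galois_twist \<sigma> D)"
proof (intro gcrossed_braided_category.intro faithfully_graded_category_galois_twist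
    action_on_category_galois_twist)
  show "faithfully_graded_category G D" "action_on_category G D"
    using assms by (rule gcrossed_braided_category.axioms)+
  show "gcrossed_braided_category_axioms G (galois_twist \<sigma> D)"
    using gcrossed_braided_category.axioms(3)[OF assms]
    unfolding gcrossed_braided_category_axioms_def galois_twist_linear
      galois_twist_monoidal galois_twist_scal_free galois_twist_asc_inv galois_twist_gcrossed .
qed

section \<open>Traces, dimensions and modularity\<close>

text \<open>The arrow \<open>h\<close> that defines the trace is unchanged. As the unit is simple,
  \<open>h\<close> is a unique multiple \<open>t\<close> of its identity, and the twisted scalar
  with the same effect is \<open>\<sigma> t\<close>.\<close>

lemma trace_galois_twist:
  assumes "spherical_fusion_category C" "x \<in> Ob C" "f \<in> Hom C x x"
  shows "trace (galois_twist \<sigma> C) x f = \<sigma> (trace C x f)"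
proof -
  interpret spherical_fusion_category C by fact
  interpret vector_space "scal C" by (rule arrows_vector_space)
  define h where "h = rev C x \<bullet>\<^bsub>C\<^esub> (f \<star>\<^bsub>C\<^esub> idt C (dual C x)) \<bullet>\<^bsub>C\<^esub> lcoev C x"
  have "f \<star>\<^bsub>C\<^esub> idt C (dual C x) \<in> Hom C (x \<boxtimes>\<^bsub>C\<^esub> dual C x) (x \<boxtimes>\<^bsub>C\<^esub> dual C x)"
    using assms by (intro tar_in_Hom dual_in_Ob idt_in_Hom)
  then have "h \<in> Hom C \<I>\<^bsub>C\<^esub> \<I>\<^bsub>C\<^esub>"
    unfolding h_def using assms
    by (meson cmp_in_Hom dual_in_Ob lcoev_in_Hom rev_in_Hom tob_in_Ob unit_in_Ob)
  then obtain t where t: "h = scal C t (idt C \<I>\<^bsub>C\<^esub>)" and nz: "idt C \<I>\<^bsub>C\<^esub> \<noteq> 0"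
    using unit_simple unfolding simple_object_def by blast
  then have eq: "h = scal C u (idt C \<I>\<^bsub>C\<^esub>) \<longleftrightarrow> u = t" for u
    by (auto dest: scale_right_imp_eq)
  then have "unit_scalar C h = t"
    unfolding unit_scalar_def by simp
  moreover have "unit_scalar (galois_twist \<sigma> C) h = \<sigma> t"
    unfolding unit_scalar_def galois_twist_linear galois_twist_monoidal eq
    by (rule the_equality) auto
  ultimately show ?thesis
    by (simp add: trace_def h_def)
qed

lemma qdim_galois_twist:
  assumes "spherical_fusion_category C" "x \<in> Ob C"
  shows "qdim (galois_twist \<sigma> C) x = \<sigma> (qdim C x)"
proof -
  interpret spherical_fusion_category C by fact
  show ?thesis
    using trace_galois_twist[OF assms idt_in_Hom] assms by (simp add: qdim_def)
qed

text \<open>Entries of the S matrix are traces, so twisting applies \<open>\<sigma>\<close> to each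
  of them. The inverse of \<open>\<sigma>\<close> carries a kernel vector of the new matrix to one
  of the old, which is zero.\<close>

lemma modular_category_galois_twist:
  assumes "modular_category C"
  shows "modular_category (galois_twist \<sigma> C)"
proof (intro modular_category.intro braided_spherical_fusion_category_galois_twist)
  interpret modular_category C by fact
  show "braided_spherical_fusion_category C" by unfold_locales
  have S: "S_entry (galois_twist \<sigma> C) x y = \<sigma> (S_entry C x y)" if "x \<in> Ob C" "y \<in> Ob C" for x y
  proof -
    have "braid C y x \<bullet>\<^bsub>C\<^esub> braid C x y \<in> Hom C (x \<boxtimes>\<^bsub>C\<^esub> y) (x \<boxtimes>\<^bsub>C\<^esub> y)"
      using that braid_iso unfolding iso_in_def by (meson cmp_in_Hom tob_in_Ob)
    then show ?thesis
      using that trace_galois_twist[OF spherical_fusion_category_axioms]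
      by (simp add: S_entry_def tob_in_Ob)
  qed
  show "modular_category_axioms (galois_twist \<sigma> C)"
  proof
    fix I \<phi> y
    assume I: "finite I" "simple_representatives (galois_twist \<sigma> C) I" and y: "y \<in> I"
      and sum: "\<And>x. x \<in> I \<Longrightarrow> (\<Sum>y\<in>I. S_entry (galois_twist \<sigma> C) x y * \<phi> y) = 0"
    have I_Ob: "x \<in> Ob C" if "x \<in> I" for x
      using I(2) that by (simp add: simple_representatives_def simple_object_def)
    have "(\<Sum>y\<in>I. S_entry C x y * the_inv \<sigma> (\<phi> y)) = 0" if "x \<in> I" for x
    proof -
      have "\<sigma> (\<Sum>y\<in>I. S_entry C x y * the_inv \<sigma> (\<phi> y)) = (\<Sum>y\<in>I. S_entry (galois_twist \<sigma> C) x y * \<phi> y)"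
        using that I_Ob by (simp add: hom_sum hom_mult S)
      with sum[OF that] show ?thesis by simp
    qed
    then have "the_inv \<sigma> (\<phi> y) = 0"
      using S_nondegenerate[of I "\<lambda>y. the_inv \<sigma> (\<phi> y)"] I y by simp
    then show "\<phi> y = 0" by simp
  qed
qed

end

section \<open>Nonvanishing of fusion spaces\<close>

lemma (in linear_category) zero_in_Hom: "\<lbrakk>x \<in> Ob C; y \<in> Ob C\<rbrakk> \<Longrightarrow> 0 \<in> Hom C x y"
proof -
  interpret V: vector_space "scal C" by (rule arrows_vector_space)
  show "\<lbrakk>x \<in> Ob C; y \<in> Ob C\<rbrakk> \<Longrightarrow> 0 \<in> Hom C x y"
    by (rule V.subspace_0[OF Hom_subspace])
qed

lemma (in linear_category) cmp_zero_left:
  assumes "x \<in> Ob C" "y \<in> Ob C" "z \<in> Ob C" "f \<in> Hom C x y"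
  shows "0 \<bullet> f = 0"
  using cmp_add_left[OF assms zero_in_Hom zero_in_Hom] assms by simp

lemma (in linear_category) cmp_zero_right:
  assumes "x \<in> Ob C" "y \<in> Ob C" "z \<in> Ob C" "g \<in> Hom C y z"
  shows "g \<bullet> 0 = 0"
  using cmp_add_right[OF assms(1-3) zero_in_Hom zero_in_Hom assms(4)] assms by simp

lemma (in linear_category) iso_in_nonzero:
  assumes "x \<in> Ob C" "y \<in> Ob C" "iso_in C x y f" "idt C y \<noteq> 0"
  shows "f \<noteq> 0"
  using assms cmp_zero_left[of y x y] by (auto simp: iso_in_def)

lemma (in linear_category) idt_nonzero_iso:
  assumes "x \<in> Ob C" "y \<in> Ob C" "iso_in C x y f" "idt C x \<noteq> 0"
  shows "idt C y \<noteq> 0"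
proof
  assume "idt C y = 0"
  then have "f = 0"
    using cmp_idt_left[of x y f] cmp_zero_left[of x y y f] assms by (simp add: iso_in_def)
  then show False
    using cmp_zero_right[of x y x] assms by (auto simp: iso_in_def)
qed

context pivotal_linear_category
begin

lemma tar_zero_right:
  assumes "x \<in> Ob C" "x' \<in> Ob C" "y \<in> Ob C" "y' \<in> Ob C" "f \<in> Hom C x x'"
  shows "f \<star> 0 = 0"
  using tar_add_right[OF assms(1,3,2,4,5) zero_in_Hom zero_in_Hom] assms by simp

text \<open>Otherwise the snake identity would make \<open>lun C x\<close> vanish, although it is an
  isomorphism onto a nonzero object.\<close>

lemma lev_nonzero:
  assumes x: "x \<in> Ob C" and nz: "idt C x \<noteq> 0"
  shows "lev C x \<noteq> 0"
proof
  assume lev: "lev C x = 0"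
  have d: "dual C x \<in> Ob C" using x by (rule dual_in_Ob)
  note ob = x d unit_in_Ob tob_in_Ob
  have 0: "idt C x \<star> lev C x = 0"
    unfolding lev using ob by (intro tar_zero_right[of x x "dual C x \<boxtimes> x" \<I>] idt_in_Hom) auto
  have "lcoev C x \<star> idt C x \<in> Hom C (\<I> \<boxtimes> x) ((x \<boxtimes> dual C x) \<boxtimes> x)"
    using ob by (intro tar_in_Hom lcoev_in_Hom idt_in_Hom) auto
  moreover have "asc C x (dual C x) x \<in> Hom C ((x \<boxtimes> dual C x) \<boxtimes> x) (x \<boxtimes> (dual C x \<boxtimes> x))"
    using asc_iso[of x "dual C x" x] ob by (simp add: iso_in_def)
  ultimately have "asc C x (dual C x) x \<bullet> (lcoev C x \<star> idt C x)
      \<in> Hom C (\<I> \<boxtimes> x) (x \<boxtimes> (dual C x \<boxtimes> x))"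
    using ob by (intro cmp_in_Hom[where y = "(x \<boxtimes> dual C x) \<boxtimes> x"]) auto
  then have "0 \<bullet> asc C x (dual C x) x \<bullet> (lcoev C x \<star> idt C x) = 0"
    using ob by (intro cmp_zero_left[where z = "x \<boxtimes> \<I>"]) auto
  moreover have "run C x \<bullet> 0 = 0"
    using run_iso[OF x] ob
    by (intro cmp_zero_right[of "x \<boxtimes> \<I>" "x \<boxtimes> \<I>" x]) (auto simp: iso_in_def)
  ultimately have "lun C x = 0"
    using left_snake[OF x] unfolding 0 by simp
  then show False
    using iso_in_nonzero[OF _ x lun_iso[OF x] nz] ob by blast
qed

text \<open>The argument of \<open>lev_nonzero\<close> applied to \<open>right_snake_dual\<close>,
  which yields \<open>lun\<close> at the dual; hence the hypothesis on
  \<open>dual C x\<close>.\<close>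

lemma rev_nonzero:
  assumes x: "x \<in> Ob C" and nz: "idt C (dual C x) \<noteq> 0"
  shows "rev C x \<noteq> 0"
proof
  assume rev: "rev C x = 0"
  have d: "dual C x \<in> Ob C" using x by (rule dual_in_Ob)
  note ob = x d unit_in_Ob tob_in_Ob
  have 0: "idt C (dual C x) \<star> rev C x = 0"
    unfolding rev using ob
    by (intro tar_zero_right[of "dual C x" "dual C x" "x \<boxtimes> dual C x" \<I>] idt_in_Hom) auto
  have "rcoev C x \<star> idt C (dual C x) \<in> Hom C (\<I> \<boxtimes> dual C x) ((dual C x \<boxtimes> x) \<boxtimes> dual C x)"
    using ob by (intro tar_in_Hom rcoev_in_Hom idt_in_Hom) auto
  moreover have "asc C (dual C x) x (dual C x)
      \<in> Hom C ((dual C x \<boxtimes> x) \<boxtimes> dual C x) (dual C x \<boxtimes> (x \<boxtimes> dual C x))"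
    using asc_iso[of "dual C x" x "dual C x"] ob by (simp add: iso_in_def)
  ultimately have "asc C (dual C x) x (dual C x) \<bullet> (rcoev C x \<star> idt C (dual C x))
      \<in> Hom C (\<I> \<boxtimes> dual C x) (dual C x \<boxtimes> (x \<boxtimes> dual C x))"
    using ob by (intro cmp_in_Hom[where y = "(dual C x \<boxtimes> x) \<boxtimes> dual C x"]) auto
  then have "0 \<bullet> asc C (dual C x) x (dual C x) \<bullet> (rcoev C x \<star> idt C (dual C x)) = 0"
    using ob by (intro cmp_zero_left[where z = "dual C x \<boxtimes> \<I>"]) auto
  moreover have "run C (dual C x) \<bullet> 0 = 0"
    using run_iso[OF d] ob
    by (intro cmp_zero_right[of "dual C x \<boxtimes> \<I>" "dual C x \<boxtimes> \<I>" "dual C x"])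
      (auto simp: iso_in_def)
  ultimately have "lun C (dual C x) = 0"
    using right_snake_dual[OF x] unfolding 0 by simp
  then show False
    using iso_in_nonzero[OF _ d lun_iso[OF d] nz] ob by blast
qed

text \<open>The isomorphism turns the evaluations of \<open>x\<close> into arrows on the two tensor
  products. Were such an arrow zero, composing it with the inverse would make the evaluation
  zero.\<close>

lemma Hom_tensor_dual_nonzero:
  assumes x: "x \<in> Ob C" "idt C x \<noteq> 0" and y: "y \<in> Ob C" "idt C y \<noteq> 0"
    and iso: "isomorphic_in C y (dual C x)"
  shows "Hom C (x \<boxtimes> y) \<I> \<noteq> {0}" "Hom C (y \<boxtimes> x) \<I> \<noteq> {0}"
proof -
  have d: "dual C x \<in> Ob C" using x(1) by (rule dual_in_Ob)
  obtain k where "iso_in C y (dual C x) k"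
    using iso by (auto simp: isomorphic_in_def)
  then obtain k' where k: "k \<in> Hom C y (dual C x)" "k' \<in> Hom C (dual C x) y"
      "k \<bullet> k' = idt C (dual C x)" and nz: "idt C (dual C x) \<noteq> 0"
    using idt_nonzero_iso[OF y(1) d _ y(2)] by (auto simp: iso_in_def)
  note ob = x(1) y(1) d unit_in_Ob tob_in_Ob
  have tar: "idt C x \<star> k \<in> Hom C (x \<boxtimes> y) (x \<boxtimes> dual C x)"
      "idt C x \<star> k' \<in> Hom C (x \<boxtimes> dual C x) (x \<boxtimes> y)"
      "k \<star> idt C x \<in> Hom C (y \<boxtimes> x) (dual C x \<boxtimes> x)"
      "k' \<star> idt C x \<in> Hom C (dual C x \<boxtimes> x) (y \<boxtimes> x)"
    using ob k by (auto intro!: tar_in_Hom idt_in_Hom)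
  show "Hom C (x \<boxtimes> y) \<I> \<noteq> {0}"
  proof
    assume "Hom C (x \<boxtimes> y) \<I> = {0}"
    then have 0: "rev C x \<bullet> (idt C x \<star> k) = 0"
      using cmp_in_Hom[OF _ _ _ tar(1) rev_in_Hom[OF x(1)]] ob by auto
    have "(idt C x \<star> k) \<bullet> (idt C x \<star> k') = idt C (x \<boxtimes> dual C x)"
      using tar_cmp[of x "dual C x" x y x "dual C x" "idt C x" "idt C x" k' k] ob k
      by (simp add: idt_in_Hom cmp_idt_left[OF x(1) x(1)] tar_idt)
    then have "rev C x = (rev C x \<bullet> (idt C x \<star> k)) \<bullet> (idt C x \<star> k')"
      using cmp_assoc[OF _ _ _ _ tar(2,1) rev_in_Hom[OF x(1)]] ob
        cmp_idt_right[OF _ _ rev_in_Hom[OF x(1)]] by simp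
    also have "\<dots> = 0"
      unfolding 0 using ob by (intro cmp_zero_left[OF _ _ _ tar(2), of \<I>]) auto
    finally show False using rev_nonzero[OF x(1) nz] by blast
  qed
  show "Hom C (y \<boxtimes> x) \<I> \<noteq> {0}"
  proof
    assume "Hom C (y \<boxtimes> x) \<I> = {0}"
    then have 0: "lev C x \<bullet> (k \<star> idt C x) = 0"
      using cmp_in_Hom[OF _ _ _ tar(3) lev_in_Hom[OF x(1)]] ob by auto
    have "(k \<star> idt C x) \<bullet> (k' \<star> idt C x) = idt C (dual C x \<boxtimes> x)"
      using tar_cmp[of "dual C x" x y x "dual C x" x k' k "idt C x" "idt C x"] ob k
      by (simp add: idt_in_Hom cmp_idt_left[OF x(1) x(1)] tar_idt)
    then have "lev C x = (lev C x \<bullet> (k \<star> idt C x)) \<bullet> (k' \<star> idt C x)"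
      using cmp_assoc[OF _ _ _ _ tar(4,3) lev_in_Hom[OF x(1)]] ob
        cmp_idt_right[OF _ _ lev_in_Hom[OF x(1)]] by simp
    also have "\<dots> = 0"
      unfolding 0 using ob by (intro cmp_zero_left[OF _ _ _ tar(4), of \<I>]) auto
    finally show False using lev_nonzero[OF x] by blast
  qed
qed

end

text \<open>
  The normalisation of the pivotal coefficients mentions this entry without requiring its index to
  be admissible, but \<^verbatim>\<open>q\<close> is only controlled on admissible entries.
\<close>

lemma pivotal_F_entry:
  assumes "spherical_fusion_category C" and gp: "gauge_presentation C A X v" and a: "a \<in> labels A"
  shows "Fsym A a (bar A a) a a (vac A, 0, 0) (vac A, 0, 0) \<in> symbol_entries A"
proof -
  interpret spherical_fusion_category C by fact
  interpret V: vector_space "scal C" by (rule arrows_vector_space)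
  have lab: "vac A \<in> labels A" "bar A a \<in> labels A"
    using gp a unfolding gauge_presentation_def by auto
  have simple: "simple_object C (X b)" if "b \<in> labels A" for b
    using gp that by (simp add: gauge_presentation_def simple_representatives_def)
  then have ob: "X b \<in> Ob C" and nz: "idt C (X b) \<noteq> 0" if "b \<in> labels A" for b
    using that by (auto simp: simple_object_def)
  have vac: "X (vac A) = \<I>\<^bsub>C\<^esub>"
    using gp by (simp add: gauge_presentation_def)
  have "V.span (v b c d ` {..<fus A b c d}) = Hom C (X b \<boxtimes>\<^bsub>C\<^esub> X c) (X d)"
    if "b \<in> labels A" "c \<in> labels A" "d \<in> labels A" for b c d
    using gp that by (simp add: gauge_presentation_def)
  \<comment> \<open>A multiplicity 0 would leave an empty basis, whose span is zero.\<close>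
  then have pos: "0 < fus A b c d"
    if "b \<in> labels A" "c \<in> labels A" "d \<in> labels A" "Hom C (X b \<boxtimes>\<^bsub>C\<^esub> X c) (X d) \<noteq> {0}" for b c d
    using that by (metis V.span_empty gr0I image_empty lessThan_0)
  have "isomorphic_in C (X (bar A a)) (dual C (X a))"
    using gp a by (simp add: gauge_presentation_def)
  from Hom_tensor_dual_nonzero[OF ob[OF a] nz[OF a] ob[OF lab(2)] nz[OF lab(2)] this]
  have "0 < fus A a (bar A a) (vac A)" "0 < fus A (bar A a) a (vac A)"
    using pos a lab by (simp_all add: vac)
  moreover have "lun C (X a) \<noteq> 0" "run C (X a) \<noteq> 0"
    using iso_in_nonzero[OF _ ob[OF a] lun_iso[OF ob[OF a]] nz[OF a]]
      iso_in_nonzero[OF _ ob[OF a] run_iso[OF ob[OF a]] nz[OF a]] tob_in_Ob unit_in_Ob ob[OF a]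
    by blast+
  then have "Hom C (\<I>\<^bsub>C\<^esub> \<boxtimes>\<^bsub>C\<^esub> X a) (X a) \<noteq> {0}" "Hom C (X a \<boxtimes>\<^bsub>C\<^esub> \<I>\<^bsub>C\<^esub>) (X a) \<noteq> {0}"
    using lun_iso[OF ob[OF a]] run_iso[OF ob[OF a]] by (auto simp: iso_in_def)
  then have "0 < fus A (vac A) a a" "0 < fus A a (vac A) a"
    using pos a lab by (simp_all add: vac)
  \<comment> \<open>The four inequalities say that \<open>(vac A, 0, 0)\<close> is both an
    admissible row and an admissible column.\<close>
  ultimately show ?thesis
    using a lab unfolding symbol_entries_def left_channels_def right_channels_def by blast
qed

section \<open>Galois conjugation of theories\<close>

context complex_automorphism
begin

text \<open>The same objects \<open>X\<close> and basis vectors \<open>v\<close> serve for the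
  twist: bases stay bases, and the coefficients of the old expansions are replaced by their images
  under \<open>\<sigma>\<close>.\<close>

lemma gauge_presentation_galois_twist:
  assumes C: "spherical_fusion_category C" and gp: "gauge_presentation C A X v"
    and q: "\<And>x. x \<in> symbol_entries A \<Longrightarrow> q x = \<sigma> x"
  shows "gauge_presentation (galois_twist \<sigma> C) (galois_conjugate q A) X v"
proof -
  interpret spherical_fusion_category C by fact
  have sel: "labels (galois_conjugate q A) = labels A" "vac (galois_conjugate q A) = vac A"
    "bar (galois_conjugate q A) = bar A" "fus (galois_conjugate q A) = fus A"
    "eps (galois_conjugate q A) = eps A"
    "left_channels (galois_conjugate q A) = left_channels A"
    "right_channels (galois_conjugate q A) = right_channels A"
    by (simp_all add: galois_conjugate_def fun_eq_iff left_channels_def right_channels_def)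
  \<comment> \<open>A conjugated symbol acts in the twist through \<open>the_inv \<sigma>\<close>,
    which restores the original symbol at admissible indices.\<close>
  have F: "the_inv \<sigma> (Fsym (galois_conjugate q A) a b c d r s) = Fsym A a b c d r s"
    if "a \<in> labels A" "b \<in> labels A" "c \<in> labels A" "d \<in> labels A"
      "r \<in> left_channels A a b c d" "s \<in> right_channels A a b c d" for a b c d r s
  proof -
    have "Fsym A a b c d r s \<in> symbol_entries A"
      using that unfolding symbol_entries_def by blast
    then show ?thesis by (simp add: galois_conjugate_def q)
  qed
  have R: "the_inv \<sigma> (Rsym (galois_conjugate q A) a b c \<mu> \<nu>) = Rsym A a b c \<mu> \<nu>"
    if "a \<in> labels A" "b \<in> labels A" "c \<in> labels A" "\<mu> < fus A b a c" "\<nu> < fus A a b c"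
    for a b c \<mu> \<nu>
  proof -
    have "Rsym A a b c \<mu> \<nu> \<in> symbol_entries A"
      using that unfolding symbol_entries_def by blast
    then show ?thesis by (simp add: galois_conjugate_def q)
  qed
  have eps: "qdim (galois_twist \<sigma> C) (X a) *
      Fsym (galois_conjugate q A) a (bar A a) a a (vac A, 0, 0) (vac A, 0, 0) = of_int (eps A a)"
    if a: "a \<in> labels A" for a
  proof -
    have "X a \<in> Ob C"
      using gp a by (simp add: gauge_presentation_def simple_representatives_def simple_object_def)
    then have "qdim (galois_twist \<sigma> C) (X a) *
        Fsym (galois_conjugate q A) a (bar A a) a a (vac A, 0, 0) (vac A, 0, 0)
      = \<sigma> (qdim C (X a) * Fsym A a (bar A a) a a (vac A, 0, 0) (vac A, 0, 0))"
      using q[OF pivotal_F_entry[OF C gp a]]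
      by (simp add: qdim_galois_twist[OF C] galois_conjugate_def hom_mult)
    \<comment> \<open>The pivotal coefficients are integers and hence fixed by
      \<open>\<sigma>\<close>.\<close>
    also have "\<dots> = of_int (eps A a)"
      using gp a by (simp add: gauge_presentation_def hom_of_int)
    finally show ?thesis .
  qed
  have F_moves: "\<forall>a\<in>labels A. \<forall>b\<in>labels A. \<forall>c\<in>labels A. \<forall>d\<in>labels A.
      \<forall>(e, \<alpha>, \<beta>) \<in> left_channels A a b c d.
        v e c d \<beta> \<bullet>\<^bsub>C\<^esub> (v a b e \<alpha> \<star>\<^bsub>C\<^esub> idt C (X c)) =
        (\<Sum>(f, \<mu>, \<nu>) \<in> right_channels A a b c d.
          scal C (Fsym A a b c d (e, \<alpha>, \<beta>) (f, \<mu>, \<nu>))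
            (v a f d \<nu> \<bullet>\<^bsub>C\<^esub> (idt C (X a) \<star>\<^bsub>C\<^esub> v b c f \<mu>) \<bullet>\<^bsub>C\<^esub> asc C (X a) (X b) (X c)))"
    using gp unfolding gauge_presentation_def by (elim conjE)
  have F_move: "v e c d \<beta> \<bullet>\<^bsub>C\<^esub> (v a b e \<alpha> \<star>\<^bsub>C\<^esub> idt C (X c)) =
      (\<Sum>(f, \<mu>, \<nu>) \<in> right_channels A a b c d.
        scal C (the_inv \<sigma> (Fsym (galois_conjugate q A) a b c d (e, \<alpha>, \<beta>) (f, \<mu>, \<nu>)))
          (v a f d \<nu> \<bullet>\<^bsub>C\<^esub> (idt C (X a) \<star>\<^bsub>C\<^esub> v b c f \<mu>) \<bullet>\<^bsub>C\<^esub> asc C (X a) (X b) (X c)))"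
    if "a \<in> labels A" "b \<in> labels A" "c \<in> labels A" "d \<in> labels A"
      "(e, \<alpha>, \<beta>) \<in> left_channels A a b c d" for a b c d e \<alpha> \<beta>
  proof -
    have "v e c d \<beta> \<bullet>\<^bsub>C\<^esub> (v a b e \<alpha> \<star>\<^bsub>C\<^esub> idt C (X c)) =
      (\<Sum>(f, \<mu>, \<nu>) \<in> right_channels A a b c d.
        scal C (Fsym A a b c d (e, \<alpha>, \<beta>) (f, \<mu>, \<nu>))
          (v a f d \<nu> \<bullet>\<^bsub>C\<^esub> (idt C (X a) \<star>\<^bsub>C\<^esub> v b c f \<mu>) \<bullet>\<^bsub>C\<^esub> asc C (X a) (X b) (X c)))"
      using F_moves that by fast
    also have "\<dots> = (\<Sum>(f, \<mu>, \<nu>) \<in> right_channels A a b c d.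
        scal C (the_inv \<sigma> (Fsym (galois_conjugate q A) a b c d (e, \<alpha>, \<beta>) (f, \<mu>, \<nu>)))
          (v a f d \<nu> \<bullet>\<^bsub>C\<^esub> (idt C (X a) \<star>\<^bsub>C\<^esub> v b c f \<mu>) \<bullet>\<^bsub>C\<^esub> asc C (X a) (X b) (X c)))"
      by (rule sum.cong) (auto simp: F that)
    finally show ?thesis .
  qed
  have R_move: "v b a c \<mu> \<bullet>\<^bsub>C\<^esub> braid C (X a) (X b) =
      (\<Sum>\<nu> < fus A a b c. scal C (the_inv \<sigma> (Rsym (galois_conjugate q A) a b c \<mu> \<nu>)) (v a b c \<nu>))"
    if "a \<in> labels A" "b \<in> labels A" "c \<in> labels A" "\<mu> < fus A b a c" for a b c \<mu>
    using gp that by (simp add: gauge_presentation_def R)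
  have "\<forall>a\<in>labels A. eps A a \<in> {1, -1} \<and> qdim (galois_twist \<sigma> C) (X a) *
      Fsym (galois_conjugate q A) a (bar A a) a a (vac A, 0, 0) (vac A, 0, 0) = of_int (eps A a)"
    using gp eps by (simp add: gauge_presentation_def)
  moreover have "\<forall>a\<in>labels A. \<forall>b\<in>labels A. \<forall>c\<in>labels A. \<forall>d\<in>labels A.
      \<forall>(e, \<alpha>, \<beta>) \<in> left_channels A a b c d.
        v e c d \<beta> \<bullet>\<^bsub>C\<^esub> (v a b e \<alpha> \<star>\<^bsub>C\<^esub> idt C (X c)) =
        (\<Sum>(f, \<mu>, \<nu>) \<in> right_channels A a b c d.
          scal C (the_inv \<sigma> (Fsym (galois_conjugate q A) a b c d (e, \<alpha>, \<beta>) (f, \<mu>, \<nu>)))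
            (v a f d \<nu> \<bullet>\<^bsub>C\<^esub> (idt C (X a) \<star>\<^bsub>C\<^esub> v b c f \<mu>) \<bullet>\<^bsub>C\<^esub> asc C (X a) (X b) (X c)))"
    by (intro ballI, clarify) (rule F_move)
  moreover have "\<forall>a\<in>labels A. \<forall>b\<in>labels A. \<forall>c\<in>labels A. \<forall>\<mu> < fus A b a c.
      v b a c \<mu> \<bullet>\<^bsub>C\<^esub> braid C (X a) (X b) =
      (\<Sum>\<nu> < fus A a b c. scal C (the_inv \<sigma> (Rsym (galois_conjugate q A) a b c \<mu> \<nu>)) (v a b c \<nu>))"
    by (intro ballI allI impI) (rule R_move)
  ultimately show ?thesis
    using gp
    unfolding gauge_presentation_def sel galois_twist_linear galois_twist_monoidal
      galois_twist_pivotal galois_twist_braid galois_twist_scal_free scal_galois_twist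
      simple_representatives_galois_twist
      span_twist[OF arrows_vector_space] dependent_twist[OF arrows_vector_space]
    by (elim conjE, intro conjI)
qed

lemma tqft_galois_twist: "tqft (C, s) \<Longrightarrow> tqft (galois_twist \<sigma> C, s)"
  by (simp add: tqft_def modular_category_galois_twist)

lemma describes_galois_twist:
  assumes "tqft (C, s')" "describes (A, s) (C, s')"
    and "\<And>x. x \<in> symbol_entries A \<Longrightarrow> q x = \<sigma> x"
  shows "describes (galois_conjugate q A, s) (galois_twist \<sigma> C, s')"
proof -
  have "modular_category C" using assms(1) by (simp add: tqft_def)
  then have "spherical_fusion_category C"
    by (intro braided_spherical_fusion_category.axioms modular_category.axioms)
  moreover obtain X v where "gauge_presentation C A X v" "s = s'"
    using assms(2) by (auto simp: describes_def)
  ultimately have "gauge_presentation (galois_twist \<sigma> C) (galois_conjugate q A) X v"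
    using assms(3) by (intro gauge_presentation_galois_twist)
  with \<open>s = s'\<close> show ?thesis
    unfolding describes_def fst_conv snd_conv by blast
qed

lemma is_tqft_galois_conjugate:
  fixes U :: "('o \<times> 'm::ab_group_add) itself"
  assumes "is_tqft U (A, s)" "\<And>x. x \<in> symbol_entries A \<Longrightarrow> q x = \<sigma> x"
  shows "is_tqft U (galois_conjugate q A, s)"
proof -
  obtain C :: "('o, 'm) braided_cat" and s' where "tqft (C, s')" "describes (A, s) (C, s')"
    using assms(1) unfolding is_tqft_def by (metis surj_pair)
  then have "tqft (galois_twist \<sigma> C, s')"
    "describes (galois_conjugate q A, s) (galois_twist \<sigma> C, s')"
    using tqft_galois_twist describes_galois_twist assms(2) by blast+
  then show ?thesis unfolding is_tqft_def by blast
qed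

text \<open>The ungauged theory and its crossed extension are twisted together. Both the trivial
  component and the equivariantization commute with the twist, so the two remain matched.\<close>

lemma obtained_by_gauging_galois_conjugate:
  fixes U :: "('o \<times> 'm::ab_group_add) itself" and G :: "('g, 'z) monoid_scheme"
  assumes "obtained_by_gauging U G (A, s)" "\<And>x. x \<in> symbol_entries A \<Longrightarrow> q x = \<sigma> x"
  shows "obtained_by_gauging U G (galois_conjugate q A, s)"
proof -
  obtain \<T> :: "('o, 'm) braided_cat \<times> int" and D :: "('o, 'm, 'g) gcrossed_cat"
    where *: "tqft \<T>" "gcrossed_braided_category G D" "trivial_component G D = fst \<T>"
      "tqft (gauged_theory G \<T> D)" "describes (A, s) (gauged_theory G \<T> D)"
    using assms(1) unfolding obtained_by_gauging_def by blast
  let ?T = "(galois_twist \<sigma> (fst \<T>), snd \<T>)" and ?D = "galois_twist \<sigma> D"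
  have gauged: "gauged_theory G ?T ?D = (galois_twist \<sigma> (equivariantization G D), snd \<T>)"
    by (simp add: gauged_theory_def equivariantization_galois_twist)
  have "tqft ?T"
    using *(1) tqft_galois_twist[of "fst \<T>" "snd \<T>"] by simp
  moreover have "gcrossed_braided_category G ?D" "trivial_component G ?D = fst ?T"
    using *(2,3) gcrossed_braided_category_galois_twist by (auto simp: trivial_component_galois_twist)
  moreover have "tqft (gauged_theory G ?T ?D)"
    unfolding gauged using *(4) by (intro tqft_galois_twist) (simp add: gauged_theory_def)
  moreover have "describes (galois_conjugate q A, s) (gauged_theory G ?T ?D)"
    unfolding gauged using *(4,5) assms(2)
    by (intro describes_galois_twist) (simp_all add: gauged_theory_def)
  ultimately show ?thesis unfolding obtained_by_gauging_def by blast
qed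

end

section \<open>From Galois automorphisms of the symbol field to complex automorphisms\<close>

lemma symbol_entries_subset_mtc_field: "symbol_entries A \<subseteq> mtc_field A"
  unfolding mtc_field_def normal_closure_def
  by (auto intro: generate_field.incl)

text \<open>Every normal field containing the symbols is closed under the ring operations, and
  closure passes to their intersection \<open>mtc_field A\<close>, so that
  \<open>automorphism_extension\<close> applies.\<close>

lemma Gal_mtc_field_extends:
  assumes "q \<in> Gal (mtc_field A)"
  shows "\<exists>\<sigma>. complex_automorphism \<sigma> \<and> (\<forall>x\<in>mtc_field A. \<sigma> x = q x)"
proof -
  let ?L = "mtc_field A"
  have 1: "1 \<in> L" "\<And>x y. \<lbrakk>x \<in> L; y \<in> L\<rbrakk> \<Longrightarrow> x + y \<in> L" "\<And>x y. \<lbrakk>x \<in> L; y \<in> L\<rbrakk> \<Longrightarrow> x * y \<in> L"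
    "\<And>x. x \<in> L \<Longrightarrow> \<ominus>\<^bsub>complex_field\<^esub> x \<in> L"
    if "normal_over_rat L" for L
  proof -
    have "subring L complex_field"
      using that by (auto simp: normal_over_rat_def intro: subfieldE)
    from subringE[OF this] show "1 \<in> L" "\<And>x y. \<lbrakk>x \<in> L; y \<in> L\<rbrakk> \<Longrightarrow> x + y \<in> L"
      "\<And>x y. \<lbrakk>x \<in> L; y \<in> L\<rbrakk> \<Longrightarrow> x * y \<in> L" "\<And>x. x \<in> L \<Longrightarrow> \<ominus>\<^bsub>complex_field\<^esub> x \<in> L"
      by (auto simp: complex_field_def)
  qed
  \<comment> \<open>Additive inverses in the record \<open>complex_field\<close> are definite
    descriptions and have to be identified with ordinary negation.\<close>
  have minus: "\<ominus>\<^bsub>complex_field\<^esub> x = - x" for x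
  proof -
    have "(THE y. x + y = 0 \<and> y + x = 0) = - x"
      by (rule the_equality) (auto simp: eq_neg_iff_add_eq_0 add.commute)
    then show ?thesis
      by (simp add: a_inv_def m_inv_def complex_field_def)
  qed
  have L: "1 \<in> ?L" "\<And>x y. \<lbrakk>x \<in> ?L; y \<in> ?L\<rbrakk> \<Longrightarrow> x * y \<in> ?L"
    "\<And>x y. \<lbrakk>x \<in> ?L; y \<in> ?L\<rbrakk> \<Longrightarrow> x + y \<in> ?L" "\<And>x. x \<in> ?L \<Longrightarrow> - x \<in> ?L"
    using 1 unfolding mtc_field_def normal_closure_def minus by blast+
  have hom: "q 1 = 1" "\<And>x y. \<lbrakk>x \<in> ?L; y \<in> ?L\<rbrakk> \<Longrightarrow> q (x * y) = q x * q y"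
    "\<And>x y. \<lbrakk>x \<in> ?L; y \<in> ?L\<rbrakk> \<Longrightarrow> q (x + y) = q x + q y" "bij_betw q ?L ?L"
    using assms by (auto simp: Gal_def ring_iso_def ring_hom_def complex_field_def)
  have diff: "x - y \<in> ?L" "q (x - y) = q x - q y" if "x \<in> ?L" "y \<in> ?L" for x y
  proof -
    show "x - y \<in> ?L"
      using L(3)[OF that(1) L(4)[OF that(2)]] by simp
    from hom(3)[OF this that(2)] show "q (x - y) = q x - q y"
      by simp
  qed
  show ?thesis
    using automorphism_extension[OF L(1) diff(1) L(2) hom(1) diff(2) hom(2,4)]
    by (simp add: complex_automorphism_def)
qed

theorem theorem4p6:
  fixes G :: "('g, 'z) monoid_scheme"
    and C :: "'a mtc_data" and s :: int
    and K :: "complex set" and q :: "complex \<Rightarrow> complex"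
  assumes "group G" and "finite (carrier G)"
    and "is_tqft TYPE('p \<times> 'n::ab_group_add) (C, s)"
    and "number_field K" and "symbol_entries C \<subseteq> K"
    and "obtained_by_gauging TYPE('o \<times> 'm::ab_group_add) G (C, s)"
    and "q \<in> Gal (mtc_field C)"
  shows "is_tqft TYPE('p \<times> 'n) (galois_conjugate q C, s) \<and>
         obtained_by_gauging TYPE('o \<times> 'm) G (galois_conjugate q C, s)"
proof -
  obtain \<sigma> where "complex_automorphism \<sigma>" and \<sigma>: "\<And>x. x \<in> mtc_field C \<Longrightarrow> \<sigma> x = q x"
    using Gal_mtc_field_extends[OF assms(7)] by blast
  interpret complex_automorphism \<sigma> by fact
  have "q x = \<sigma> x" if "x \<in> symbol_entries C" for x
    using \<sigma> that symbol_entries_subset_mtc_field by (metis subsetD)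
  \<comment> \<open>One \<open>\<sigma>\<close> serves both conclusions, although the two categories
    may live in different universes.\<close>
  then show ?thesis
    using is_tqft_galois_conjugate[OF assms(3)] obtained_by_gauging_galois_conjugate[OF assms(6)]
    by blast
qed

end
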